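(* (Hereditary substitution respects typing.) Let $\Sigma$ be a CoLF signature with $\Sigma\ \mathsf{sig}$. If $\Gamma\vdash_{\Xi;\Sigma}N\Leftarrow A$ and $\Gamma,x{:}A,\Gamma'\vdash_{\Xi;\Sigma}M\Leftarrow B$, then $\Gamma,[N/x]^{A^o}\Gamma'\vdash_{\Xi;\Sigma}[N/x]^{A^o}M\Leftarrow[N/x]^{A^o}B$.
   Context: CoLF syntax: signatures contain $a:K$, $c:A$, $r:A=M$; contexts $\Gamma::=\cdot\mid\Gamma,x{:}A\mid\Gamma,x\,\hat{:}\,A$ (the latter a prepattern variable); kinds $K::=\mathsf{type}\mid\mathsf{cotype}\mid\Pi x{:}A.K\mid\Pi x\,\hat{:}\,A.K$; types $A::=a\cdot S\mid\Pi x{:}A_2.A_1\mid\Pi x\,\hat{:}\,A_2.A_1$; terms $M::=H\cdot S\mid\lambda x.M$, $H::=x\mid c\mid r$; spines $S::=()\mid M;S\mid[y];S$. Erasure: $(\Pi x{:}A_2.A_1)^o=A_2^o\to A_1^o$, $(\Pi x\,\hat{:}\,A_2.A_1)^o=*\to A_1^o$, atomic types erase to $*$. Renaming $\{y/x\}$ and hereditary substitution $[N/x]^\tau$ (partial, extended homomorphically to kinds, types, contexts): $[N/x]^\tau(x\cdot S)=([N/x]^\tau S)\rhd^\tau N$, $[N/x]^\tau(H\cdot S)=H\cdot[N/x]^\tau S$ for $H\neq x$, $[N/x]^\tau([x];S)$ undefined, $[N/x]^\tau([z];S)=[z];[N/x]^\tau S$; $()\rhd^*R=R$, $(N;S)\rhd^{\tau_2\to\tau_1}(\lambda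 x.M)=S\rhd^{\tau_1}([N/x]^{\tau_2}M)$, $([y];S)\rhd^{*\to\tau_1}(\lambda x.M)=S\rhd^{\tau_1}(\{y/x\}M)$. Typing (bidirectional, parametrised by a checked local prefix $\Xi$ of the global signature $\Sigma$): $\lambda x.M\Leftarrow\Pi x{:}A_2.A_1$ (resp. $\Pi x\,\hat{:}\,A_2.A_1$) if $\Gamma,x{:}A_2\vdash M\Leftarrow A_1$ (resp. $\Gamma,x\,\hat{:}\,A_2$); $R\Leftarrow P$ if $R\Rightarrow P'$ and $P'=P$; $H\cdot S\Rightarrow P$ if $H$ has type $A$ (from $\Gamma$, from a constructor in $\Xi$, or a recursion constant in $\Xi$ — or in $\Sigma$ while checking bodies of recursive definitions) and $S\rhd A\Rightarrow P$; spine typing: $()\rhd P\Rightarrow P$; $M;S\rhd\Pi x{:}A_2.A_1\Rightarrow P$ if $M\Leftarrow A_2$ and $S\rhd[M/x]^{A_2^o}A_1\Rightarrow P$; $[y];S\rhd\Pi x\,\hat{:}\,A_2.A_1\Rightarrow P$ if $y\,\hat{:}\,A_2'\in\Gamma$, $A_2'=A_2$ and $S\rhd\{y/x\}A_1\Rightarrow P$. Type equality $a\cdot S=a\cdot S'$ holds iff $\cdot;|\Gamma|\vdash_\Sigma S=S'$ in the CoLF term equality (equality of the infinite Böhm-tree unfoldings), extended structurally to $\Pi$-types; kinds and types are checked analogously, atomic $a\cdot S$ synthesising its kind via $a:K\in\Xi$ and spine application. $\Sigma\ \mathsf{sig}$ means every declaration is well-formed in this sense in order (kinds and types checked against earlier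 declarations), every recursion declaration $r:A=M$ has $A$ consisting only of prepattern $\Pi$'s, $M$ contractive (head not a recursion constant), all occurrences of $r$ in $M$ guarded by a coinductive constructor of highest priority on the trace (priority: type families declared later have higher priority; a constructor is coinductive if its target family has kind ending in $\mathsf{cotype}$), and every body $M$ checks against $A$.
   Formalization: The usual presuppositions are made explicit: the context Γ, x:A, Γ' is assumed well-formed and B a well-formed type in it; otherwise [N/x]Γ' or [N/x]B may be undefined (e.g. an unused declaration containing [x]). The conclusion also asserts that the substitutions are defined. *)

theory Defs
  imports "HOL-Library.Sublist" "HOL-Library.Monad_Syntax"
begin

section \<open>Syntax\<close>

text \<open>
  Variables are de Bruijn indices.  A binder of mode \<open>Ord\<close> is \<open>x : A\<close>, one of mode \<open>Pre\<close> is
  the prepattern binder \<open>x ^: A\<close>.  The spine \<open>PArg y S\<close> is \<open>[y]; S\<close>.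
\<close>

type_synonym name = string

datatype head = Var nat | Con name | is_Rec: Rec name

datatype tm = App head sp | Lam tm
  and sp = SNil | Arg tm sp | PArg nat sp

datatype bmode = Ord | Pre

datatype ty = Atom name sp | Pi bmode ty ty

datatype kind = KType | KCotype | KPi bmode ty kind

datatype decl = DFam name kind | DCon name ty | DRec name ty tm

text \<open>
  Signatures are in order of declaration; contexts have the most recently bound variable first,
  so \<open>\<Gamma>, x : A, \<Gamma>'\<close> is \<open>\<Gamma>' @ (Ord, A) # \<Gamma>\<close> and \<open>x\<close> has index \<open>length \<Gamma>'\<close> in it.
\<close>

type_synonym signat = "decl list"
type_synonym ctx = "(bmode \<times> ty) list"

primrec decl_name :: "decl \<Rightarrow> name" where
  "decl_name (DFam a K) = a"
| "decl_name (DCon c A) = c"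
| "decl_name (DRec r A M) = r"

datatype sty = Base | Arr sty sty

primrec erase :: "ty \<Rightarrow> sty" where
  "erase (Atom a S) = Base"
| "erase (Pi m A2 A1) = Arr (case m of Ord \<Rightarrow> erase A2 | Pre \<Rightarrow> Base) (erase A1)"

section \<open>Renaming\<close>

primrec up :: "(nat \<Rightarrow> nat) \<Rightarrow> nat \<Rightarrow> nat" where
  "up f 0 = 0"
| "up f (Suc i) = Suc (f i)"

primrec ren_head :: "(nat \<Rightarrow> nat) \<Rightarrow> head \<Rightarrow> head" where
  "ren_head f (Var i) = Var (f i)"
| "ren_head f (Con c) = Con c"
| "ren_head f (Rec r) = Rec r"

primrec ren_tm :: "(nat \<Rightarrow> nat) \<Rightarrow> tm \<Rightarrow> tm"
  and ren_sp :: "(nat \<Rightarrow> nat) \<Rightarrow> sp \<Rightarrow> sp" where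
  "ren_tm f (App h S) = App (ren_head f h) (ren_sp f S)"
| "ren_tm f (Lam M) = Lam (ren_tm (up f) M)"
| "ren_sp f SNil = SNil"
| "ren_sp f (Arg M S) = Arg (ren_tm f M) (ren_sp f S)"
| "ren_sp f (PArg y S) = PArg (f y) (ren_sp f S)"

primrec ren_ty :: "(nat \<Rightarrow> nat) \<Rightarrow> ty \<Rightarrow> ty" where
  "ren_ty f (Atom a S) = Atom a (ren_sp f S)"
| "ren_ty f (Pi m A2 A1) = Pi m (ren_ty f A2) (ren_ty (up f) A1)"

primrec ren_kind :: "(nat \<Rightarrow> nat) \<Rightarrow> kind \<Rightarrow> kind" where
  "ren_kind f KType = KType"
| "ren_kind f KCotype = KCotype"
| "ren_kind f (KPi m A K) = KPi m (ren_ty f A) (ren_kind (up f) K)"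

text \<open>\<open>{y/x}\<close> for the most recently bound \<open>x\<close>, which disappears from the context.\<close>

definition inst :: "nat \<Rightarrow> nat \<Rightarrow> nat" where
  "inst y = case_nat y (\<lambda>i. i)"

section \<open>Hereditary substitution\<close>

text \<open>
  \<open>hsub_tm \<tau> N k M\<close> is \<open>[N/x]\<^sup>\<tau> M\<close> where \<open>x\<close> has index \<open>k\<close> in \<open>M\<close>.  The term \<open>N\<close> lives outside
  the \<open>k\<close> variables bound after \<open>x\<close> and is weakened by them when it is inserted; indices above
  \<open>k\<close> drop by one.  \<open>reduce S \<tau> N\<close> is \<open>S \<rhd>\<^sup>\<tau> N\<close>.  The result \<open>None\<close> means undefined.
\<close>

definition drop_var :: "nat \<Rightarrow> nat \<Rightarrow> nat" where
  "drop_var k i = (if i < k then i else i - 1)"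

function (sequential) hsub_tm :: "sty \<Rightarrow> tm \<Rightarrow> nat \<Rightarrow> tm \<Rightarrow> tm option"
  and hsub_sp :: "sty \<Rightarrow> tm \<Rightarrow> nat \<Rightarrow> sp \<Rightarrow> sp option"
  and reduce :: "sp \<Rightarrow> sty \<Rightarrow> tm \<Rightarrow> tm option" where
  "hsub_tm \<tau> N k (Lam M) = map_option Lam (hsub_tm \<tau> N (Suc k) M)"
| "hsub_tm \<tau> N k (App h S) =
     (if h = Var k
      then do { S' \<leftarrow> hsub_sp \<tau> N k S; reduce S' \<tau> (ren_tm (\<lambda>i. i + k) N) }
      else map_option (App (ren_head (drop_var k) h)) (hsub_sp \<tau> N k S))"
| "hsub_sp \<tau> N k SNil = Some SNil"
| "hsub_sp \<tau> N k (Arg M S) =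
     do { M' \<leftarrow> hsub_tm \<tau> N k M; S' \<leftarrow> hsub_sp \<tau> N k S; Some (Arg M' S') }"
| "hsub_sp \<tau> N k (PArg y S) =
     (if y = k then None else map_option (PArg (drop_var k y)) (hsub_sp \<tau> N k S))"
| "reduce SNil Base (App h S) = Some (App h S)"
| "reduce (Arg N S) (Arr \<tau>2 \<tau>1) (Lam M) =
     do { M' \<leftarrow> hsub_tm \<tau>2 N 0 M; reduce S \<tau>1 M' }"
| "reduce (PArg y S) (Arr Base \<tau>1) (Lam M) = reduce S \<tau>1 (ren_tm (inst y) M)"
| "reduce _ _ _ = None"
  by pat_completeness auto
termination
  by (relation "measures
       [\<lambda>x. case x of Inl (\<tau>, _) \<Rightarrow> size \<tau> | Inr (Inl (\<tau>, _)) \<Rightarrow> size \<tau> | Inr (Inr (_, \<tau>, _)) \<Rightarrow> size \<tau>,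
        \<lambda>x. case x of Inl (_, _, _, M) \<Rightarrow> Suc (size M) | Inr (Inl (_, _, _, S)) \<Rightarrow> Suc (size S)
                     | Inr (Inr _) \<Rightarrow> 0]") auto

primrec hsub_ty :: "sty \<Rightarrow> tm \<Rightarrow> nat \<Rightarrow> ty \<Rightarrow> ty option" where
  "hsub_ty \<tau> N k (Atom a S) = map_option (Atom a) (hsub_sp \<tau> N k S)"
| "hsub_ty \<tau> N k (Pi m A2 A1) =
     do { A2' \<leftarrow> hsub_ty \<tau> N k A2; A1' \<leftarrow> hsub_ty \<tau> N (Suc k) A1; Some (Pi m A2' A1') }"

primrec hsub_kind :: "sty \<Rightarrow> tm \<Rightarrow> nat \<Rightarrow> kind \<Rightarrow> kind option" where
  "hsub_kind \<tau> N k KType = Some KType"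
| "hsub_kind \<tau> N k KCotype = Some KCotype"
| "hsub_kind \<tau> N k (KPi m A K) =
     do { A' \<leftarrow> hsub_ty \<tau> N k A; K' \<leftarrow> hsub_kind \<tau> N (Suc k) K; Some (KPi m A' K') }"

text \<open>\<open>hsub_ctx \<tau> N \<Gamma>'\<close> substitutes for the variable bound immediately before \<open>\<Gamma>'\<close>.\<close>

fun hsub_ctx :: "sty \<Rightarrow> tm \<Rightarrow> ctx \<Rightarrow> ctx option" where
  "hsub_ctx \<tau> N [] = Some []"
| "hsub_ctx \<tau> N ((m, A) # \<Gamma>') =
     do { A' \<leftarrow> hsub_ty \<tau> N (length \<Gamma>') A; \<Gamma>'' \<leftarrow> hsub_ctx \<tau> N \<Gamma>'; Some ((m, A') # \<Gamma>'') }"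

section \<open>Equality of infinite unfoldings\<close>

datatype 'a barg = BArg 'a | BPArg nat

codatatype btree = BApp head "btree barg list" | BLam btree

inductive sp_rel :: "(tm \<Rightarrow> btree \<Rightarrow> bool) \<Rightarrow> sp \<Rightarrow> btree barg list \<Rightarrow> bool" for R where
  sp_rel_nil: "sp_rel R SNil []"
| sp_rel_arg: "R M T \<Longrightarrow> sp_rel R S Ts \<Longrightarrow> sp_rel R (Arg M S) (BArg T # Ts)"
| sp_rel_parg: "sp_rel R S Ts \<Longrightarrow> sp_rel R (PArg y S) (BPArg y # Ts)"

lemma sp_rel_mono [mono]:
  assumes "\<And>M T. R M T \<longrightarrow> R' M T"
  shows "sp_rel R S Ts \<longrightarrow> sp_rel R' S Ts"
proof
  assume "sp_rel R S Ts"
  then show "sp_rel R' S Ts"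
    by induction (use assms in \<open>auto intro: sp_rel.intros\<close>)
qed

text \<open>
  \<open>unfolds \<Sigma> M T\<close>: the infinite Boehm tree of \<open>M\<close>, obtained by unfolding recursion constants
  at the head, is \<open>T\<close>.  Since recursive definitions are required to be contractive, one
  unfolding step exposes a head that is not a recursion constant.
\<close>

coinductive unfolds :: "signat \<Rightarrow> tm \<Rightarrow> btree \<Rightarrow> bool" for \<Sigma> where
  unfolds_lam: "unfolds \<Sigma> M T \<Longrightarrow> unfolds \<Sigma> (Lam M) (BLam T)"
| unfolds_app: "\<not> is_Rec h \<Longrightarrow> sp_rel (unfolds \<Sigma>) S Ts \<Longrightarrow> unfolds \<Sigma> (App h S) (BApp h Ts)"
| unfolds_rec:
    "DRec r A M \<in> set \<Sigma> \<Longrightarrow> reduce S (erase A) M = Some (App h S') \<Longrightarrow> \<not> is_Rec h \<Longrightarrow>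
     sp_rel (unfolds \<Sigma>) S' Ts \<Longrightarrow> unfolds \<Sigma> (App (Rec r) S) (BApp h Ts)"

definition sp_eq :: "signat \<Rightarrow> sp \<Rightarrow> sp \<Rightarrow> bool" where
  "sp_eq \<Sigma> S S' \<longleftrightarrow> (\<exists>Ts. sp_rel (unfolds \<Sigma>) S Ts \<and> sp_rel (unfolds \<Sigma>) S' Ts)"

inductive ty_eq :: "signat \<Rightarrow> ty \<Rightarrow> ty \<Rightarrow> bool" for \<Sigma> where
  ty_eq_atom: "sp_eq \<Sigma> S S' \<Longrightarrow> ty_eq \<Sigma> (Atom a S) (Atom a S')"
| ty_eq_pi: "ty_eq \<Sigma> A2 A2' \<Longrightarrow> ty_eq \<Sigma> A1 A1' \<Longrightarrow> ty_eq \<Sigma> (Pi m A2 A1) (Pi m A2' A1')"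

section \<open>Typing\<close>

text \<open>
  The judgments are relative to a local signature \<open>\<Xi>\<close> and the global signature \<open>\<Sigma>\<close>.  Recursion
  constants are drawn from \<open>\<Xi>\<close>, except that the bodies of recursive definitions are checked in
  phase \<open>In_Body\<close>, where all those of \<open>\<Sigma>\<close> are available (mutual recursion).
\<close>

datatype phase = In_Decl | In_Body

primrec rec_scope :: "phase \<Rightarrow> signat \<Rightarrow> signat \<Rightarrow> signat" where
  "rec_scope In_Decl \<Xi> \<Sigma> = \<Xi>"
| "rec_scope In_Body \<Xi> \<Sigma> = \<Sigma>"

definition in_ctx :: "ctx \<Rightarrow> nat \<Rightarrow> bmode \<Rightarrow> ty \<Rightarrow> bool" where
  "in_ctx \<Gamma> i m A \<longleftrightarrow> (\<exists>A0. i < length \<Gamma> \<and> \<Gamma> ! i = (m, A0) \<and> A = ren_ty (\<lambda>j. j + Suc i) A0)"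

inductive head_ty :: "signat \<Rightarrow> signat \<Rightarrow> phase \<Rightarrow> ctx \<Rightarrow> head \<Rightarrow> ty \<Rightarrow> bool" for \<Xi> \<Sigma> p \<Gamma> where
  "in_ctx \<Gamma> i m A \<Longrightarrow> head_ty \<Xi> \<Sigma> p \<Gamma> (Var i) A"
| "DCon c A \<in> set \<Xi> \<Longrightarrow> head_ty \<Xi> \<Sigma> p \<Gamma> (Con c) A"
| "DRec r A M \<in> set (rec_scope p \<Xi> \<Sigma>) \<Longrightarrow> head_ty \<Xi> \<Sigma> p \<Gamma> (Rec r) A"

inductive check :: "signat \<Rightarrow> signat \<Rightarrow> phase \<Rightarrow> ctx \<Rightarrow> tm \<Rightarrow> ty \<Rightarrow> bool"
  and synth :: "signat \<Rightarrow> signat \<Rightarrow> phase \<Rightarrow> ctx \<Rightarrow> tm \<Rightarrow> ty \<Rightarrow> bool"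
  and spine :: "signat \<Rightarrow> signat \<Rightarrow> phase \<Rightarrow> ctx \<Rightarrow> sp \<Rightarrow> ty \<Rightarrow> ty \<Rightarrow> bool" for \<Xi> \<Sigma> p where
  check_lam: "check \<Xi> \<Sigma> p ((m, A2) # \<Gamma>) M A1 \<Longrightarrow> check \<Xi> \<Sigma> p \<Gamma> (Lam M) (Pi m A2 A1)"
| check_neutral:
    "synth \<Xi> \<Sigma> p \<Gamma> (App h S) P' \<Longrightarrow> ty_eq \<Sigma> P' (Atom a T) \<Longrightarrow> check \<Xi> \<Sigma> p \<Gamma> (App h S) (Atom a T)"
| synth_app:
    "head_ty \<Xi> \<Sigma> p \<Gamma> h A \<Longrightarrow> spine \<Xi> \<Sigma> p \<Gamma> S A P \<Longrightarrow> synth \<Xi> \<Sigma> p \<Gamma> (App h S) P"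
| spine_nil: "spine \<Xi> \<Sigma> p \<Gamma> SNil (Atom a T) (Atom a T)"
| spine_arg:
    "check \<Xi> \<Sigma> p \<Gamma> M A2 \<Longrightarrow> hsub_ty (erase A2) M 0 A1 = Some A1' \<Longrightarrow> spine \<Xi> \<Sigma> p \<Gamma> S A1' P \<Longrightarrow>
     spine \<Xi> \<Sigma> p \<Gamma> (Arg M S) (Pi Ord A2 A1) P"
| spine_parg:
    "in_ctx \<Gamma> y Pre A2' \<Longrightarrow> ty_eq \<Sigma> A2' A2 \<Longrightarrow> spine \<Xi> \<Sigma> p \<Gamma> S (ren_ty (inst y) A1) P \<Longrightarrow>
     spine \<Xi> \<Sigma> p \<Gamma> (PArg y S) (Pi Pre A2 A1) P"

inductive kspine :: "signat \<Rightarrow> signat \<Rightarrow> phase \<Rightarrow> ctx \<Rightarrow> sp \<Rightarrow> kind \<Rightarrow> kind \<Rightarrow> bool" for \<Xi> \<Sigma> p \<Gamma> where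
  kspine_type: "kspine \<Xi> \<Sigma> p \<Gamma> SNil KType KType"
| kspine_cotype: "kspine \<Xi> \<Sigma> p \<Gamma> SNil KCotype KCotype"
| kspine_arg:
    "check \<Xi> \<Sigma> p \<Gamma> M A \<Longrightarrow> hsub_kind (erase A) M 0 K = Some K' \<Longrightarrow> kspine \<Xi> \<Sigma> p \<Gamma> S K' L \<Longrightarrow>
     kspine \<Xi> \<Sigma> p \<Gamma> (Arg M S) (KPi Ord A K) L"
| kspine_parg:
    "in_ctx \<Gamma> y Pre A' \<Longrightarrow> ty_eq \<Sigma> A' A \<Longrightarrow> kspine \<Xi> \<Sigma> p \<Gamma> S (ren_kind (inst y) K) L \<Longrightarrow>
     kspine \<Xi> \<Sigma> p \<Gamma> (PArg y S) (KPi Pre A K) L"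

text \<open>In \<open>ty_ok \<Xi> \<Sigma> p \<Gamma> A L\<close> the kind \<open>L\<close> is \<open>KType\<close> or \<open>KCotype\<close>.\<close>

inductive ty_ok :: "signat \<Rightarrow> signat \<Rightarrow> phase \<Rightarrow> ctx \<Rightarrow> ty \<Rightarrow> kind \<Rightarrow> bool" for \<Xi> \<Sigma> p where
  ty_ok_atom: "DFam a K \<in> set \<Xi> \<Longrightarrow> kspine \<Xi> \<Sigma> p \<Gamma> S K L \<Longrightarrow> ty_ok \<Xi> \<Sigma> p \<Gamma> (Atom a S) L"
| ty_ok_pi:
    "ty_ok \<Xi> \<Sigma> p \<Gamma> A2 L2 \<Longrightarrow> ty_ok \<Xi> \<Sigma> p ((m, A2) # \<Gamma>) A1 L \<Longrightarrow> ty_ok \<Xi> \<Sigma> p \<Gamma> (Pi m A2 A1) L"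

inductive kind_ok :: "signat \<Rightarrow> signat \<Rightarrow> phase \<Rightarrow> ctx \<Rightarrow> kind \<Rightarrow> bool" for \<Xi> \<Sigma> p where
  kind_ok_type: "kind_ok \<Xi> \<Sigma> p \<Gamma> KType"
| kind_ok_cotype: "kind_ok \<Xi> \<Sigma> p \<Gamma> KCotype"
| kind_ok_pi:
    "ty_ok \<Xi> \<Sigma> p \<Gamma> A L \<Longrightarrow> kind_ok \<Xi> \<Sigma> p ((m, A) # \<Gamma>) K \<Longrightarrow> kind_ok \<Xi> \<Sigma> p \<Gamma> (KPi m A K)"

inductive ctx_ok :: "signat \<Rightarrow> signat \<Rightarrow> phase \<Rightarrow> ctx \<Rightarrow> bool" for \<Xi> \<Sigma> p where
  ctx_ok_nil: "ctx_ok \<Xi> \<Sigma> p []"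
| ctx_ok_cons: "ctx_ok \<Xi> \<Sigma> p \<Gamma> \<Longrightarrow> ty_ok \<Xi> \<Sigma> p \<Gamma> A L \<Longrightarrow> ctx_ok \<Xi> \<Sigma> p ((m, A) # \<Gamma>)"

section \<open>Recursive definitions\<close>

primrec prepattern_ty :: "ty \<Rightarrow> bool" where
  "prepattern_ty (Atom a S) \<longleftrightarrow> True"
| "prepattern_ty (Pi m A2 A1) \<longleftrightarrow> m = Pre \<and> prepattern_ty A1"

fun contractive :: "tm \<Rightarrow> bool" where
  "contractive (Lam M) = contractive M"
| "contractive (App h S) = (\<not> is_Rec h)"

text \<open>
  The traces of \<open>r\<close> in \<open>M\<close>: for each occurrence of \<open>r\<close>, the heads on the path from the root of
  \<open>M\<close> to the parent of that occurrence.
\<close>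

primrec traces :: "name \<Rightarrow> tm \<Rightarrow> head list set"
  and traces_sp :: "name \<Rightarrow> sp \<Rightarrow> head list set" where
  "traces r (App h S) = (if h = Rec r then {[]} else {}) \<union> (\<lambda>t. h # t) ` traces_sp r S"
| "traces r (Lam M) = traces r M"
| "traces_sp r SNil = {}"
| "traces_sp r (Arg M S) = traces r M \<union> traces_sp r S"
| "traces_sp r (PArg y S) = traces_sp r S"

primrec target :: "ty \<Rightarrow> name" where
  "target (Atom a S) = a"
| "target (Pi m A2 A1) = target A1"

primrec is_cotype :: "kind \<Rightarrow> bool" where
  "is_cotype KType \<longleftrightarrow> False"
| "is_cotype KCotype \<longleftrightarrow> True"
| "is_cotype (KPi m A K) \<longleftrightarrow> is_cotype K"

text \<open>
  The priority of a constructor is the position at which its target family is declared in \<open>\<Sigma>\<close>.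
\<close>

definition con_priority :: "signat \<Rightarrow> name \<Rightarrow> nat \<Rightarrow> bool" where
  "con_priority \<Sigma> c n \<longleftrightarrow>
     (\<exists>A K. DCon c A \<in> set \<Sigma> \<and> n < length \<Sigma> \<and> \<Sigma> ! n = DFam (target A) K)"

definition con_coinductive :: "signat \<Rightarrow> name \<Rightarrow> bool" where
  "con_coinductive \<Sigma> c \<longleftrightarrow>
     (\<exists>A K. DCon c A \<in> set \<Sigma> \<and> DFam (target A) K \<in> set \<Sigma> \<and> is_cotype K)"

definition guarded :: "signat \<Rightarrow> name \<Rightarrow> tm \<Rightarrow> bool" where
  "guarded \<Sigma> r M \<longleftrightarrow>
     (\<forall>t \<in> traces r M. \<exists>c n. Con c \<in> set t \<and> con_coinductive \<Sigma> c \<and> con_priority \<Sigma> c n \<and>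
        (\<forall>c' n'. Con c' \<in> set t \<longrightarrow> con_priority \<Sigma> c' n' \<longrightarrow> n' \<le> n))"

section \<open>Signatures\<close>

primrec decl_ok :: "signat \<Rightarrow> signat \<Rightarrow> decl \<Rightarrow> bool" where
  "decl_ok \<Xi> \<Sigma> (DFam a K) \<longleftrightarrow> kind_ok \<Xi> \<Sigma> In_Decl [] K"
| "decl_ok \<Xi> \<Sigma> (DCon c A) \<longleftrightarrow> (\<exists>L. ty_ok \<Xi> \<Sigma> In_Decl [] A L)"
| "decl_ok \<Xi> \<Sigma> (DRec r A M) \<longleftrightarrow>
     (\<exists>L. ty_ok \<Xi> \<Sigma> In_Decl [] A L) \<and> prepattern_ty A \<and> contractive M \<and> guarded \<Sigma> r M \<and>
     check \<Xi> \<Sigma> In_Body [] M A"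

text \<open>Distinctness is the usual convention that no name is declared twice.\<close>

definition sig_ok :: "signat \<Rightarrow> bool" where
  "sig_ok \<Sigma> \<longleftrightarrow> distinct (map decl_name \<Sigma>) \<and>
     (\<forall>\<Xi> d \<Omega>. \<Sigma> = \<Xi> @ d # \<Omega> \<longrightarrow> decl_ok \<Xi> \<Sigma> d)"

end

theory Submission
  imports Defs
begin

text \<open>
  Presuppositions enter only through simple typing: well-typed terms and types are simply typed
  with respect to skeletons, and simple typing already makes hereditary substitution total and
  gives the composition law \<open>[N/x][P/y] M = [[N/x] P/y][N/x] M\<close>, by induction on the sum of the
  sizes of the two skeletons and then on \<open>M\<close>.

  The critical point is that substitution for an ordinary variable \<open>x\<close> respects equality of the
  infinite unfoldings.  Recursion constants take prepattern variables as their only arguments, so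
  \<open>x\<close> never occurs below one and occurs only finitely often in an unfolding.  Induction on the
  finite term therefore suffices: if one of two equal terms is headed by a recursion constant,
  then \<open>x\<close> occurs in neither, and substituting for it only renumbers variables.

  Typing is then preserved by induction on the skeleton of \<open>A\<close> and the derivation for \<open>M\<close>; in the
  case of a head \<open>x\<close>, reducing \<open>N\<close> against its spine substitutes at smaller skeletons.
\<close>

subsection \<open>Renaming\<close>

text \<open>Typing and hereditary substitution are entangled: \<open>spine_arg\<close> contains a
  substitution into a type, so definedness and composition of substitutions have to be known before
  typing can be shown to be preserved. Simple typing involves neither substitution nor conversion,
  which breaks the circle.

  The synthesised type of a neutral term survives substitution only up to \<open>ty_eq\<close>: when
  the head \<open>x\<close> is replaced, the neutral term that surfaces from \<open>N\<close> was
  merely checked, that is, up to a conversion. Hence \<open>ty_eq\<close> has to be an equivalence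
  relation on simply well-formed types. Transitivity rests on determinism of \<open>unfolds\<close>,
  reflexivity on the existence of an unfolding, which uses contractiveness.

  Coinduction on trees suits renaming, which keeps every node, but not substitution:
  \<open>reduce\<close> consumes nodes of the trees instead of producing them.\<close>

lemma sp_induct [case_names SNil Arg PArg]:
  assumes "P SNil" and "\<And>M S. P S \<Longrightarrow> P (Arg M S)" and "\<And>y S. P S \<Longrightarrow> P (PArg y S)"
  shows "P S"
proof -
  have "M = M" and "P S" for M :: tm by (induction M and S) (use assms in auto)
  then show ?thesis by simp
qed

lemma up_comp: "up f \<circ> up g = up (f \<circ> g)"
  by (rule ext) (case_tac x, auto)

lemma up_id [simp]: "up (\<lambda>i. i) = (\<lambda>i. i)"
proof
  show "up (\<lambda>i. i) i = i" for i by (cases i) auto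
qed

lemma ren_head_comp: "ren_head f (ren_head g h) = ren_head (f \<circ> g) h"
  by (cases h) auto

lemma ren_comp:
  "ren_tm f (ren_tm g M) = ren_tm (f \<circ> g) M"
  "ren_sp f (ren_sp g S) = ren_sp (f \<circ> g) S"
  by (induction M and S arbitrary: f g and f g) (auto simp: ren_head_comp up_comp)

lemma ren_ty_comp: "ren_ty f (ren_ty g A) = ren_ty (f \<circ> g) A"
  by (induction A arbitrary: f g) (auto simp: ren_comp up_comp)

lemma ren_head_id [simp]: "ren_head (\<lambda>i. i) h = h"
  by (cases h) auto

lemma ren_id [simp]: "ren_tm (\<lambda>i. i) M = M" "ren_sp (\<lambda>i. i) S = S"
  by (induction M and S) auto

lemma ren_ty_id [simp]: "ren_ty (\<lambda>i. i) A = A"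
  by (induction A) auto

lemma inst_simps [simp]: "inst y 0 = y" "inst y (Suc i) = i"
  by (auto simp: inst_def)

lemma is_Rec_ren_head [simp]: "is_Rec (ren_head f h) = is_Rec h"
  by (cases h) auto

text \<open>
  The condition under which \<open>f ([N/k] M) = [f0 N/k'] (f' M)\<close>: here \<open>f'\<close> acts on the context of \<open>M\<close>,
  \<open>f\<close> on that context without \<open>k\<close>, and \<open>f0\<close> on the context of \<open>N\<close>.
\<close>

definition sub_ren_compat :: "(nat \<Rightarrow> nat) \<Rightarrow> (nat \<Rightarrow> nat) \<Rightarrow> (nat \<Rightarrow> nat) \<Rightarrow> nat \<Rightarrow> nat \<Rightarrow> bool" where
  "sub_ren_compat f f' f0 k k' \<longleftrightarrow> f' k = k' \<and>
     (\<forall>i. i \<noteq> k \<longrightarrow> f' i \<noteq> k' \<and> f (drop_var k i) = drop_var k' (f' i)) \<and> (\<forall>i. f (i + k) = f0 i + k')"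

lemma sub_ren_compat_up:
  assumes "sub_ren_compat f f' f0 k k'"
  shows "sub_ren_compat (up f) (up f') f0 (Suc k) (Suc k')"
proof -
  have "up f (drop_var (Suc k) i) = drop_var (Suc k') (up f' i) \<and> up f' i \<noteq> Suc k'" if "i \<noteq> Suc k" for i
  proof (cases i)
    case (Suc i')
    then have "f (drop_var k i') = drop_var k' (f' i')" "f' i' \<noteq> k'"
      using assms that by (auto simp: sub_ren_compat_def)
    moreover have "drop_var (Suc k) (Suc i') = Suc (drop_var k i')"
      "drop_var (Suc k') (Suc (f' i')) = Suc (drop_var k' (f' i'))"
      using Suc that calculation by (auto simp: drop_var_def)
    ultimately show ?thesis using Suc by simp
  qed (auto simp: drop_var_def)
  then show ?thesis using assms by (auto simp: sub_ren_compat_def)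
qed

lemma sub_ren_compat_0: "sub_ren_compat f (up f) f 0 0"
proof -
  have "up f i \<noteq> 0 \<and> f (drop_var 0 i) = drop_var 0 (up f i)" if "i \<noteq> 0" for i
    using that by (cases i) (auto simp: drop_var_def)
  then show ?thesis by (auto simp: sub_ren_compat_def)
qed

text \<open>This makes \<open>{y/z}\<close> commute with substitution for \<open>x\<close>. Index
  \<open>Suc k\<close> becomes \<open>k\<close> because the binder \<open>z\<close> disappears. The
  case \<open>y = k\<close> has to be excluded, since substitution is undefined on
  \<open>[x]\<close>.\<close>

lemma sub_ren_compat_inst:
  "y \<noteq> k \<Longrightarrow> sub_ren_compat (inst (drop_var k y)) (inst y) (\<lambda>i. i) (Suc k) k"
  by (auto simp: sub_ren_compat_def inst_def drop_var_def split: nat.splits)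

lemma sub_ren_compat_Suc: "sub_ren_compat Suc Suc (\<lambda>i. i) k (Suc k)"
  by (auto simp: sub_ren_compat_def drop_var_def)

lemma sub_ren_compat_head:
  assumes "sub_ren_compat f f' f0 k k'"
  shows "ren_head f' h = Var k' \<longleftrightarrow> h = Var k"
    and "h \<noteq> Var k \<Longrightarrow> ren_head (drop_var k') (ren_head f' h) = ren_head f (ren_head (drop_var k) h)"
  using assms by (cases h; auto simp: sub_ren_compat_def)+

lemma hsub_ren:
  "sub_ren_compat f f' f0 k k' \<Longrightarrow>
     hsub_tm \<tau> (ren_tm f0 N) k' (ren_tm f' M) = map_option (ren_tm f) (hsub_tm \<tau> N k M)"
  "sub_ren_compat f f' f0 k k' \<Longrightarrow>
     hsub_sp \<tau> (ren_tm f0 N) k' (ren_sp f' S) = map_option (ren_sp f) (hsub_sp \<tau> N k S)"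
  "reduce (ren_sp g S') \<sigma> (ren_tm g P) = map_option (ren_tm g) (reduce S' \<sigma> P)"
proof (induction \<tau> N k M and \<tau> N k S and S' \<sigma> P arbitrary: f f' f0 k' and f f' f0 k' and g
    rule: hsub_tm_hsub_sp_reduce.induct)
  case (1 \<tau> N k M)
  then show ?case using sub_ren_compat_up[OF 1(2)]
    by (auto simp: option.map_comp comp_def)
next
  case (2 \<tau> N k h S)
  \<comment> \<open>\<open>N\<close> is inserted under \<open>k\<close> binders before the renaming
    and under \<open>k'\<close> after it; the last clause of \<open>sub_ren_compat\<close>
    reconciles the two weakenings.\<close>
  have shift: "ren_tm (\<lambda>i. i + k') (ren_tm f0 N) = ren_tm f (ren_tm (\<lambda>i. i + k) N)"
    using 2(4) by (auto simp: ren_comp sub_ren_compat_def intro!: arg_cong[where f = "\<lambda>f. ren_tm f N"])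
  show ?case
  proof (cases "h = Var k")
    case True
    then have "ren_head f' h = Var k'" using sub_ren_compat_head[OF 2(4)] by blast
    then show ?thesis using True 2(1)[OF True 2(4)] 2(2)[OF True] shift
      by (cases "hsub_sp \<tau> N k S") auto
  next
    case False
    then have "ren_head f' h \<noteq> Var k'" using sub_ren_compat_head[OF 2(4)] by blast
    then show ?thesis using False 2(3)[OF False 2(4)] sub_ren_compat_head(2)[OF 2(4) False]
      by (auto simp: option.map_comp comp_def)
  qed
next
  case (4 \<tau> N k M S)
  then show ?case
    by (cases "hsub_tm \<tau> N k M"; cases "hsub_sp \<tau> N k S") auto
next
  case (5 \<tau> N k y S)
  show ?case
  proof (cases "y = k")
    case False
    with 5 have "f' y \<noteq> k'" "f (drop_var k y) = drop_var k' (f' y)"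
      by (auto simp: sub_ren_compat_def)
    then show ?thesis using 5(1)[OF False 5(2)] False by (simp add: option.map_comp comp_def)
  qed (use 5 in \<open>simp add: sub_ren_compat_def\<close>)
next
  case (7 N S \<tau>2 \<tau>1 M)
  then show ?case using 7(1)[OF sub_ren_compat_0]
    by (cases "hsub_tm \<tau>2 N 0 M") auto
next
  case (8 y S \<tau>1 M)
  have "inst (g y) \<circ> up g = g \<circ> inst y"
    by (rule ext) (case_tac x, auto)
  then show ?case using 8[of g] by (simp add: ren_comp)
qed auto

lemma hsub_ty_ren:
  "sub_ren_compat f f' f0 k k' \<Longrightarrow>
     hsub_ty \<tau> (ren_tm f0 N) k' (ren_ty f' A) = map_option (ren_ty f) (hsub_ty \<tau> N k A)"
proof (induction A arbitrary: f f' k k')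
  case (Atom a S)
  then show ?case by (auto simp: hsub_ren option.map_comp comp_def)
next
  case (Pi m A B)
  show ?case using Pi.IH(1)[OF Pi.prems] Pi.IH(2)[OF sub_ren_compat_up[OF Pi.prems]]
    by (cases "hsub_ty \<tau> N k A"; cases "hsub_ty \<tau> N (Suc k) B") auto
qed

section \<open>Substitution for a variable that does not occur\<close>

lemma up_avoids:
  assumes "\<And>i. f i \<noteq> k"
  shows "up f i \<noteq> Suc k" "drop_var (Suc k) \<circ> up f = up (drop_var k \<circ> f)"
proof -
  show "up f i \<noteq> Suc k" using assms by (cases i) auto
  show "drop_var (Suc k) \<circ> up f = up (drop_var k \<circ> f)"
  proof
    fix i
    show "(drop_var (Suc k) \<circ> up f) i = up (drop_var k \<circ> f) i"
    proof (cases i)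
      case (Suc j)
      then show ?thesis using assms[of j] by (auto simp: drop_var_def)
    qed (simp add: drop_var_def)
  qed
qed

text \<open>Absence of the variable is expressed by being the image of a renaming that misses
  \<open>k\<close>. The substitution then never reaches \<open>N\<close>, so it is defined without
  any typing.\<close>

lemma hsub_avoid:
  "(\<And>i. f i \<noteq> k) \<Longrightarrow> hsub_tm \<tau> N k (ren_tm f M) = Some (ren_tm (drop_var k \<circ> f) M)"
  "(\<And>i. f i \<noteq> k) \<Longrightarrow> hsub_sp \<tau> N k (ren_sp f S) = Some (ren_sp (drop_var k \<circ> f) S)"
proof (induction M and S arbitrary: f k and f k)
  case (App h S)
  then have "ren_head f h \<noteq> Var k" by (cases h) auto
  then show ?case using App.IH[of f k, OF App.prems] by (simp add: ren_head_comp comp_def)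
next
  case (Lam M)
  have "hsub_tm \<tau> N (Suc k) (ren_tm (up f) M) = Some (ren_tm (drop_var (Suc k) \<circ> up f) M)"
    by (rule Lam.IH) (rule up_avoids(1)[OF Lam.prems])
  then show ?case using up_avoids(2)[of f k, OF Lam.prems] by (simp add: comp_def)
qed auto

lemma hsub_ty_avoid:
  "(\<And>i. f i \<noteq> k) \<Longrightarrow> hsub_ty \<tau> N k (ren_ty f A) = Some (ren_ty (drop_var k \<circ> f) A)"
  by (induction A arbitrary: f k) (auto simp: hsub_avoid up_avoids)

subsection \<open>Simple typing\<close>

text \<open>
  Unlike erasure, skeletons keep the mode of every binder and the full shape of the types of
  prepattern variables, which may themselves occur as heads.
\<close>

datatype sk = SB | SP bmode sk sk

primrec sk_sty :: "sk \<Rightarrow> sty" where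
  "sk_sty SB = Base"
| "sk_sty (SP m a b) = Arr (case m of Ord \<Rightarrow> sk_sty a | Pre \<Rightarrow> Base) (sk_sty b)"

primrec skel :: "ty \<Rightarrow> sk" where
  "skel (Atom a S) = SB"
| "skel (Pi m A B) = SP m (skel A) (skel B)"

primrec kskel :: "kind \<Rightarrow> sk" where
  "kskel KType = SB"
| "kskel KCotype = SB"
| "kskel (KPi m A K) = SP m (skel A) (kskel K)"

lemma erase_skel: "erase A = sk_sty (skel A)"
  by (induction A) (auto split: bmode.splits)

lemma skel_ren [simp]: "skel (ren_ty f A) = skel A"
  by (induction A arbitrary: f) auto

lemma skel_hsub: "hsub_ty \<tau> N k A = Some A' \<Longrightarrow> skel A' = skel A"
  by (induction A arbitrary: k A') (auto split: bind_splits)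

lemma kskel_ren [simp]: "kskel (ren_kind f A) = kskel A"
  by (induction A arbitrary: f) auto

lemma kskel_hsub: "hsub_kind \<tau> N k K = Some K' \<Longrightarrow> kskel K' = kskel K"
  by (induction K arbitrary: k K') (auto split: bind_splits dest: skel_hsub)

lemma skel_ty_eq: "ty_eq \<Sigma> A B \<Longrightarrow> skel A = skel B"
  by (induction rule: ty_eq.induct) auto

text \<open>A function rather than a list, so that one entry can be erased by
  \<open>\<Delta>(k := None)\<close> without renumbering the others. Being simply typed in such a
  context expresses that variable \<open>k\<close> does not occur.\<close>

type_synonym sctx = "nat \<Rightarrow> (bmode \<times> sk) option"

definition cons_ctx :: "bmode \<times> sk \<Rightarrow> sctx \<Rightarrow> sctx" where
  "cons_ctx v \<Delta> = case_nat (Some v) \<Delta>"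

definition del_ctx :: "nat \<Rightarrow> sctx \<Rightarrow> sctx" where
  "del_ctx k \<Delta> = (\<lambda>i. \<Delta> (if i < k then i else Suc i))"

lemma cons_ctx_simps [simp]: "cons_ctx v \<Delta> 0 = Some v" "cons_ctx v \<Delta> (Suc i) = \<Delta> i"
  by (auto simp: cons_ctx_def)

lemma cons_ctx_shift [simp]: "(\<lambda>i. cons_ctx v \<Delta> (i + Suc k)) = (\<lambda>i. \<Delta> (i + k))"
  by simp

lemma del_ctx_cons [simp]: "del_ctx (Suc k) (cons_ctx v \<Delta>) = cons_ctx v (del_ctx k \<Delta>)"
  by (rule ext) (case_tac x, auto simp: del_ctx_def)

lemma del_ctx_0 [simp]: "del_ctx 0 (cons_ctx v \<Delta>) = \<Delta>"
  by (auto simp: del_ctx_def)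

lemma del_ctx_drop_var: "i \<noteq> k \<Longrightarrow> del_ctx k \<Delta> (drop_var k i) = \<Delta> i"
  by (auto simp: del_ctx_def drop_var_def)

text \<open>Constants are looked up in all of \<Sigma>, so that one notion serves every local
  signature and both phases.\<close>

primrec shead :: "signat \<Rightarrow> sctx \<Rightarrow> head \<Rightarrow> sk \<Rightarrow> bool" where
  "shead \<Sigma> \<Delta> (Var i) a \<longleftrightarrow> (\<exists>m. \<Delta> i = Some (m, a))"
| "shead \<Sigma> \<Delta> (Con c) a \<longleftrightarrow> (\<exists>A. DCon c A \<in> set \<Sigma> \<and> a = skel A)"
| "shead \<Sigma> \<Delta> (Rec r) a \<longleftrightarrow> (\<exists>A M. DRec r A M \<in> set \<Sigma> \<and> a = skel A)"

primrec stm :: "signat \<Rightarrow> sctx \<Rightarrow> tm \<Rightarrow> sk \<Rightarrow> bool"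
  and ssp :: "signat \<Rightarrow> sctx \<Rightarrow> sp \<Rightarrow> sk \<Rightarrow> bool" where
  "stm \<Sigma> \<Delta> (App h S) s \<longleftrightarrow> s = SB \<and> (\<exists>a. shead \<Sigma> \<Delta> h a \<and> ssp \<Sigma> \<Delta> S a)"
| "stm \<Sigma> \<Delta> (Lam M) s \<longleftrightarrow> (\<exists>m a b. s = SP m a b \<and> stm \<Sigma> (cons_ctx (m, a) \<Delta>) M b)"
| "ssp \<Sigma> \<Delta> SNil s \<longleftrightarrow> s = SB"
| "ssp \<Sigma> \<Delta> (Arg M S) s \<longleftrightarrow> (\<exists>a b. s = SP Ord a b \<and> stm \<Sigma> \<Delta> M a \<and> ssp \<Sigma> \<Delta> S b)"
| "ssp \<Sigma> \<Delta> (PArg y S) s \<longleftrightarrow> (\<exists>a b. s = SP Pre a b \<and> \<Delta> y = Some (Pre, a) \<and> ssp \<Sigma> \<Delta> S b)"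

text \<open>The declared kind is kept in the atomic case so that, declarations being unique, any two
  spines of the same family are simply typed at the same skeleton; \<open>hsub_ty_respects\<close>
  relies on this.\<close>

primrec sty_ok :: "signat \<Rightarrow> sctx \<Rightarrow> ty \<Rightarrow> bool" where
  "sty_ok \<Sigma> \<Delta> (Atom a S) \<longleftrightarrow> (\<exists>K. DFam a K \<in> set \<Sigma> \<and> ssp \<Sigma> \<Delta> S (kskel K))"
| "sty_ok \<Sigma> \<Delta> (Pi m A B) \<longleftrightarrow> sty_ok \<Sigma> \<Delta> A \<and> sty_ok \<Sigma> (cons_ctx (m, skel A) \<Delta>) B"

definition sren :: "(nat \<Rightarrow> nat) \<Rightarrow> sctx \<Rightarrow> sctx \<Rightarrow> bool" where
  "sren f \<Delta> \<Delta>' \<longleftrightarrow> (\<forall>i v. \<Delta> i = Some v \<longrightarrow> \<Delta>' (f i) = Some v)"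

lemma sren_up: "sren f \<Delta> \<Delta>' \<Longrightarrow> sren (up f) (cons_ctx v \<Delta>) (cons_ctx v \<Delta>')"
  unfolding sren_def by (intro allI, case_tac i) auto

lemma sren_inst: "\<Delta> y = Some v \<Longrightarrow> sren (inst y) (cons_ctx v \<Delta>) \<Delta>"
  by (auto simp: sren_def inst_def cons_ctx_def split: nat.splits)

lemma shead_ren: "sren f \<Delta> \<Delta>' \<Longrightarrow> shead \<Sigma> \<Delta> h a \<Longrightarrow> shead \<Sigma> \<Delta>' (ren_head f h) a"
  by (cases h) (auto simp: sren_def)

lemma stm_ren:
  "sren f \<Delta> \<Delta>' \<Longrightarrow> stm \<Sigma> \<Delta> M s \<Longrightarrow> stm \<Sigma> \<Delta>' (ren_tm f M) s"
  "sren f \<Delta> \<Delta>' \<Longrightarrow> ssp \<Sigma> \<Delta> S s \<Longrightarrow> ssp \<Sigma> \<Delta>' (ren_sp f S) s"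
proof (induction M and S arbitrary: f \<Delta> \<Delta>' s and f \<Delta> \<Delta>' s)
  case (App h S)
  then show ?case using shead_ren by fastforce
next
  case (Lam M)
  then show ?case using sren_up by fastforce
next
  case (Arg M S)
  then show ?case by fastforce
next
  case (PArg y S)
  then show ?case by (fastforce simp: sren_def)
qed auto

lemma sty_ok_ren: "sren f \<Delta> \<Delta>' \<Longrightarrow> sty_ok \<Sigma> \<Delta> A \<Longrightarrow> sty_ok \<Sigma> \<Delta>' (ren_ty f A)"
proof (induction A arbitrary: f \<Delta> \<Delta>')
  case (Atom a S)
  then show ?case using stm_ren(2) by fastforce
next
  case (Pi m A B)
  show ?case using Pi.IH(1)[OF Pi.prems(1)] Pi.IH(2)[OF sren_up[OF Pi.prems(1)]] Pi.prems(2) by simp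
qed

text \<open>A simply typed term mentions only variables in the domain of its context. It follows
  that closed terms are fixed by every renaming and that an erased variable can be substituted
  trivially.\<close>

lemma ren_cong_stm:
  "stm \<Sigma> \<Delta> M s \<Longrightarrow> (\<And>i. \<Delta> i \<noteq> None \<Longrightarrow> f i = g i) \<Longrightarrow> ren_tm f M = ren_tm g M"
  "ssp \<Sigma> \<Delta> S s \<Longrightarrow> (\<And>i. \<Delta> i \<noteq> None \<Longrightarrow> f i = g i) \<Longrightarrow> ren_sp f S = ren_sp g S"
proof (induction M and S arbitrary: f g \<Delta> s and f g \<Delta> s)
  case (App h S)
  then obtain a where a: "shead \<Sigma> \<Delta> h a" "ssp \<Sigma> \<Delta> S a" by auto
  have "ren_sp f S = ren_sp g S" by (rule App.IH[OF a(2) App.prems(2)])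
  moreover have "ren_head f h = ren_head g h" using a(1) App.prems(2) by (cases h) auto
  ultimately show ?case by simp
next
  case (Lam M)
  then obtain m a b where "stm \<Sigma> (cons_ctx (m, a) \<Delta>) M b" by auto
  moreover have "up f i = up g i" if "cons_ctx (m, a) \<Delta> i \<noteq> None" for i
    using that Lam.prems by (cases i) auto
  ultimately have "ren_tm (up f) M = ren_tm (up g) M" by (rule Lam.IH)
  then show ?case by simp
next
  case SNil
  then show ?case by simp
next
  case (Arg M S)
  then obtain a b where "stm \<Sigma> \<Delta> M a" "ssp \<Sigma> \<Delta> S b" by auto
  then have "ren_tm f M = ren_tm g M" "ren_sp f S = ren_sp g S"
    using Arg.IH(1)[of \<Delta> a f g] Arg.IH(2)[of \<Delta> b f g] Arg.prems(2) by blast+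
  then show ?case by simp
next
  case (PArg y S)
  then obtain a b where "\<Delta> y = Some (Pre, a)" "ssp \<Sigma> \<Delta> S b" by auto
  then have "f y = g y" "ren_sp f S = ren_sp g S"
    using PArg.IH[of \<Delta> b f g] PArg.prems(2) by auto
  then show ?case by simp
qed

lemma ren_ty_cong: "sty_ok \<Sigma> \<Delta> A \<Longrightarrow> (\<And>i. \<Delta> i \<noteq> None \<Longrightarrow> f i = g i) \<Longrightarrow> ren_ty f A = ren_ty g A"
proof (induction A arbitrary: f g \<Delta>)
  case (Atom a S)
  then obtain s where "ssp \<Sigma> \<Delta> S s" by auto
  then have "ren_sp f S = ren_sp g S" by (rule ren_cong_stm(2)) (rule Atom.prems(2))
  then show ?case by simp
next
  case (Pi m A B)
  have "up f i = up g i" if "cons_ctx (m, skel A) \<Delta> i \<noteq> None" for i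
    using that Pi.prems by (cases i) auto
  then have "ren_ty (up f) B = ren_ty (up g) B"
    using Pi.prems(1) by (intro Pi.IH(2)[of "cons_ctx (m, skel A) \<Delta>"]) simp_all
  moreover have "ren_ty f A = ren_ty g A" by (rule Pi.IH(1)[of \<Delta>]) (use Pi.prems in auto)
  ultimately show ?case by simp
qed

lemma closed_ren:
  "stm \<Sigma> Map.empty M s \<Longrightarrow> ren_tm f M = M"
  "sty_ok \<Sigma> Map.empty A \<Longrightarrow> ren_ty f A = A"
  using ren_cong_stm(1)[of \<Sigma> Map.empty M s f "\<lambda>i. i"] ren_ty_cong[of \<Sigma> Map.empty A f "\<lambda>i. i"] by auto

lemma sren_empty [simp]: "sren f Map.empty \<Delta>" by (auto simp: sren_def)

lemma hsub_unused:
  assumes M: "stm \<Sigma> \<Delta> M s" and D: "\<Delta> k = None"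
  shows "hsub_tm \<tau> N k M = Some (ren_tm (drop_var k) M)"
proof -
  \<comment> \<open>Any map that misses \<open>k\<close> and is the identity on the domain of
    \<Delta> would do: it leaves \<open>M\<close> unchanged and makes \<open>hsub_avoid\<close>
    applicable.\<close>
  define f where "f = (\<lambda>i. if i = k then Suc k else i)"
  have fk: "f i \<noteq> k" for i by (simp add: f_def)
  have eq: "f i = i" if "\<Delta> i \<noteq> None" for i using that D by (auto simp: f_def)
  have "ren_tm f M = ren_tm (\<lambda>i. i) M" by (rule ren_cong_stm(1)[OF M eq])
  moreover have "ren_tm (drop_var k \<circ> f) M = ren_tm (drop_var k) M"
    by (rule ren_cong_stm(1)[OF M]) (simp add: eq)
  ultimately show ?thesis using hsub_avoid(1)[of f k \<tau> N M, OF fk] by simp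
qed

lemma hsub_ty_closed:
  assumes "sty_ok \<Sigma> Map.empty A"
  shows "hsub_ty \<tau> N k A = Some A"
  \<comment> \<open>A closed type equals its own weakening by \<open>Suc k\<close>, and that
    weakening misses \<open>k\<close>.\<close>
  using hsub_ty_avoid[of "\<lambda>i. i + Suc k" k \<tau> N A] closed_ren(2)[OF assms] by simp

text \<open>Totality and preservation of skeletons, by induction along the recursion. Mode
  \<open>Ord\<close> at \<open>k\<close> rules out the undefined case \<open>[x]\<close>, because a
  \<open>PArg\<close> needs a variable of mode \<open>Pre\<close>. \<open>N\<close> is typed in the
  part of \<Delta> that lies outside \<open>k\<close>.\<close>

lemma hsub_stm:
  "stm \<Sigma> \<Delta> M s \<Longrightarrow> \<Delta> k = Some (Ord, a) \<Longrightarrow> \<tau> = sk_sty a \<Longrightarrow> stm \<Sigma> (\<lambda>i. \<Delta> (i + Suc k)) N a \<Longrightarrow>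
     \<exists>M'. hsub_tm \<tau> N k M = Some M' \<and> stm \<Sigma> (del_ctx k \<Delta>) M' s"
  "ssp \<Sigma> \<Delta> S s \<Longrightarrow> \<Delta> k = Some (Ord, a) \<Longrightarrow> \<tau> = sk_sty a \<Longrightarrow> stm \<Sigma> (\<lambda>i. \<Delta> (i + Suc k)) N a \<Longrightarrow>
     \<exists>S'. hsub_sp \<tau> N k S = Some S' \<and> ssp \<Sigma> (del_ctx k \<Delta>) S' s"
  "ssp \<Sigma> \<Delta> S' a \<Longrightarrow> stm \<Sigma> \<Delta> P a \<Longrightarrow> \<sigma> = sk_sty a \<Longrightarrow>
     \<exists>R. reduce S' \<sigma> P = Some R \<and> stm \<Sigma> \<Delta> R SB"
proof (induction \<tau> N k M and \<tau> N k S and S' \<sigma> P arbitrary: \<Delta> s a and \<Delta> s a and \<Delta> a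
    rule: hsub_tm_hsub_sp_reduce.induct)
  case (1 \<tau> N k M)
  then obtain m b c where *: "s = SP m b c" "stm \<Sigma> (cons_ctx (m, b) \<Delta>) M c" by auto
  from 1(1)[OF *(2), of a] 1(3-) show ?case using * by auto
next
  case (2 \<tau> N k h S)
  then obtain b where b: "s = SB" "shead \<Sigma> \<Delta> h b" "ssp \<Sigma> \<Delta> S b" by auto
  show ?case
  proof (cases "h = Var k")
    case True
    with b 2(5) have "b = a" by auto
    with 2(1)[OF True b(3) 2(5-7)] obtain S' where
      S': "hsub_sp \<tau> N k S = Some S'" "ssp \<Sigma> (del_ctx k \<Delta>) S' a" by auto
    have "stm \<Sigma> (del_ctx k \<Delta>) (ren_tm (\<lambda>i. i + k) N) a"
      by (rule stm_ren(1)[OF _ 2(7)]) (auto simp: sren_def del_ctx_def)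
    from 2(2)[OF True S' this 2(6)] show ?thesis using S' True b by auto
  next
    case False
    from 2(3)[OF False b(3) 2(5-7)] obtain S' where
      S': "hsub_sp \<tau> N k S = Some S'" "ssp \<Sigma> (del_ctx k \<Delta>) S' b" by auto
    moreover have "shead \<Sigma> (del_ctx k \<Delta>) (ren_head (drop_var k) h) b"
      using b(2) False by (cases h) (auto simp: del_ctx_drop_var)
    ultimately show ?thesis using False b by auto
  qed
next
  case (3 \<tau> N k)
  then show ?case by auto
next
  case (4 \<tau> N k M S)
  then obtain b c where *: "s = SP Ord b c" "stm \<Sigma> \<Delta> M b" "ssp \<Sigma> \<Delta> S c" by auto
  from 4(1)[OF *(2) 4(4-)] 4(2)[OF _ *(3) 4(4-)] show ?case using * by auto
next
  case (5 \<tau> N k y S)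
  then obtain b c where *: "s = SP Pre b c" "\<Delta> y = Some (Pre, b)" "ssp \<Sigma> \<Delta> S c" by auto
  with 5 have "y \<noteq> k" by auto
  with 5(1)[OF _ *(3) 5(3-)] * show ?case by (auto simp: del_ctx_drop_var)
next
  case (7 N S \<tau>2 \<tau>1 M)
  then obtain b c where *: "a = SP Ord b c" "stm \<Sigma> \<Delta> N b" "ssp \<Sigma> \<Delta> S c"
    "stm \<Sigma> (cons_ctx (Ord, b) \<Delta>) M c" by auto
  from 7(1)[OF *(4), of b] * 7(5) obtain M' where "hsub_tm \<tau>2 N 0 M = Some M'" "stm \<Sigma> \<Delta> M' c" by auto
  with 7(2)[of M' \<Delta> c] * 7(5) show ?case by auto
next
  case (8 y S \<tau>1 M)
  then obtain b c where *: "a = SP Pre b c" "\<Delta> y = Some (Pre, b)" "ssp \<Sigma> \<Delta> S c"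
    "stm \<Sigma> (cons_ctx (Pre, b) \<Delta>) M c" by auto
  have "stm \<Sigma> \<Delta> (ren_tm (inst y) M) c"
    by (rule stm_ren(1)[OF _ *(4)]) (use * in \<open>auto simp: sren_def inst_def cons_ctx_def split: nat.splits\<close>)
  with 8(1)[of \<Delta> c] * 8(4) show ?case by auto
qed (auto split: bmode.splits)

lemma hsub_sty_ok:
  "sty_ok \<Sigma> \<Delta> A \<Longrightarrow> \<Delta> k = Some (Ord, a) \<Longrightarrow> stm \<Sigma> (\<lambda>i. \<Delta> (i + Suc k)) N a \<Longrightarrow>
     \<exists>A'. hsub_ty (sk_sty a) N k A = Some A' \<and> sty_ok \<Sigma> (del_ctx k \<Delta>) A'"
proof (induction A arbitrary: \<Delta> k)
  case (Atom b S)
  then show ?case using hsub_stm(2)[OF _ Atom.prems(2) refl Atom.prems(3)] by fastforce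
next
  case (Pi m A B)
  from Pi.IH(1)[OF _ Pi.prems(2,3)] Pi.prems(1) obtain A' where
    A': "hsub_ty (sk_sty a) N k A = Some A'" "sty_ok \<Sigma> (del_ctx k \<Delta>) A'" by auto
  from Pi.IH(2)[of "cons_ctx (m, skel A) \<Delta>" "Suc k"] Pi.prems obtain B' where
    "hsub_ty (sk_sty a) N (Suc k) B = Some B'" "sty_ok \<Sigma> (cons_ctx (m, skel A) (del_ctx k \<Delta>)) B'" by auto
  then show ?case using A' by (auto simp: skel_hsub)
qed

subsection \<open>Composition of hereditary substitutions\<close>

text \<open>
  \<open>[N/x][P/y] M = [[N/x] P/y][N/x] M\<close>, where \<open>y : b\<close> has index \<open>j\<close> in \<open>M\<close> and \<open>x : a\<close> has index \<open>l\<close>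
  in \<open>P\<close>, hence index \<open>j + l\<close> after \<open>y\<close> has been removed.
\<close>

definition hsub_comm :: "signat \<Rightarrow> sk \<Rightarrow> sk \<Rightarrow> bool" where
  "hsub_comm \<Sigma> b a \<longleftrightarrow> (\<forall>\<Delta> M s j l P N M1 M2 P'. stm \<Sigma> \<Delta> M s \<longrightarrow> \<Delta> j = Some (Ord, b) \<longrightarrow>
     \<Delta> (Suc (j + l)) = Some (Ord, a) \<longrightarrow> stm \<Sigma> (\<lambda>i. \<Delta> (i + Suc j)) P b \<longrightarrow>
     stm \<Sigma> (\<lambda>i. \<Delta> (i + Suc (Suc (j + l)))) N a \<longrightarrow>
     hsub_tm (sk_sty b) P j M = Some M1 \<longrightarrow> hsub_tm (sk_sty a) N (Suc (j + l)) M = Some M2 \<longrightarrow>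
     hsub_tm (sk_sty a) N l P = Some P' \<longrightarrow>
     hsub_tm (sk_sty a) N (j + l) M1 = hsub_tm (sk_sty b) P' j M2)"

lemma hsub_commD:
  assumes "hsub_comm \<Sigma> b a" and "stm \<Sigma> \<Delta> M s" and "\<Delta> j = Some (Ord, b)"
    and "\<Delta> (Suc (j + l)) = Some (Ord, a)" and "stm \<Sigma> (\<lambda>i. \<Delta> (i + Suc j)) P b"
    and "stm \<Sigma> (\<lambda>i. \<Delta> (i + Suc (Suc (j + l)))) N a"
    and "hsub_tm (sk_sty b) P j M = Some M1" and "hsub_tm (sk_sty a) N (Suc (j + l)) M = Some M2"
    and "hsub_tm (sk_sty a) N l P = Some P'"
  shows "hsub_tm (sk_sty a) N (j + l) M1 = hsub_tm (sk_sty b) P' j M2"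
  using assms unfolding hsub_comm_def by blast

text \<open>Inner induction on the skeleton \<open>b\<close> of the reduced term: an ordinary
  argument is substituted at the domain of \<open>b\<close>, which is strictly smaller, so the
  composition law is available there, and the reduction continues at the codomain. A bound
  \<open>n\<close> instead of the exact sum lets \<open>b\<close> shrink while \<open>comm\<close>
  stays fixed.\<close>

lemma hsub_reduce_step:
  assumes comm: "\<And>c a'. size c + size a' < n \<Longrightarrow> hsub_comm \<Sigma> c a'"
  shows "size b + size a \<le> n \<Longrightarrow> ssp \<Sigma> \<Delta> S b \<Longrightarrow> stm \<Sigma> \<Delta> P b \<Longrightarrow> \<Delta> k = Some (Ord, a) \<Longrightarrow>
    stm \<Sigma> (\<lambda>i. \<Delta> (i + Suc k)) N a \<Longrightarrow>
    hsub_sp (sk_sty a) N k S = Some S' \<Longrightarrow> hsub_tm (sk_sty a) N k P = Some P' \<Longrightarrow>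
    reduce S (sk_sty b) P = Some R \<Longrightarrow>
    hsub_tm (sk_sty a) N k R = reduce S' (sk_sty b) P'"
proof (induction b arbitrary: S P S' P' R)
  case SB
  then obtain h Q where P: "P = App h Q" by (cases P) auto
  have S: "S = SNil" using SB.prems by (cases S) auto
  from hsub_stm(1)[OF SB.prems(3,4) refl SB.prems(5)] SB.prems(7) have "stm \<Sigma> (del_ctx k \<Delta>) P' SB" by auto
  then obtain h' Q' where "P' = App h' Q'" by (cases P') auto
  then show ?case using SB.prems P S by auto
next
  case (SP m c d)
  then obtain Q where P: "P = Lam Q" and Q: "stm \<Sigma> (cons_ctx (m, c) \<Delta>) Q d" by (cases P) auto
  from P SP.prems(7) obtain Q' where Q': "P' = Lam Q'" "hsub_tm (sk_sty a) N (Suc k) Q = Some Q'" by auto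
  show ?case
  proof (cases S)
    case SNil
    then show ?thesis using SP.prems by simp
  next
    case (Arg X T)
    with SP.prems have m: "m = Ord" and X: "stm \<Sigma> \<Delta> X c" and T: "ssp \<Sigma> \<Delta> T d" by auto
    from Arg SP.prems(6) obtain X' T' where X': "hsub_tm (sk_sty a) N k X = Some X'"
      and T': "hsub_sp (sk_sty a) N k T = Some T'" and S': "S' = Arg X' T'"
      by (auto split: bind_splits)
    from SP.prems(8) Arg P m obtain Q1 where Q1: "hsub_tm (sk_sty c) X 0 Q = Some Q1"
      and R: "reduce T (sk_sty d) Q1 = Some R" by (auto split: bind_splits)
    have Q1t: "stm \<Sigma> \<Delta> Q1 d"
      using hsub_stm(1)[OF Q[unfolded m], of 0 c "sk_sty c" X] X Q1 by simp
    have "hsub_comm \<Sigma> c a" using SP.prems(1) by (intro comm) simp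
    \<comment> \<open>The composition law for the contracted variable, at index 0 in the body,
      against \<open>x\<close>, at index \<open>k\<close> outside that binder.\<close>
    from hsub_commD[OF this, of "cons_ctx (Ord, c) \<Delta>" Q d 0 k X N Q1 Q' X']
    have eq: "hsub_tm (sk_sty a) N k Q1 = hsub_tm (sk_sty c) X' 0 Q'"
      using Q m X X' Q1 Q' SP.prems(4,5) by simp
    from hsub_stm(1)[OF Q1t SP.prems(4) refl SP.prems(5)] obtain Q2 where
      Q2: "hsub_tm (sk_sty a) N k Q1 = Some Q2" by auto
    have "hsub_tm (sk_sty a) N k R = reduce T' (sk_sty d) Q2"
      by (rule SP.IH(2)[OF _ T Q1t SP.prems(4,5) T' Q2 R]) (use SP.prems(1) in simp)
    then show ?thesis using eq[symmetric] Q2 S' Q' m by simp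
  next
    case (PArg y T)
    with SP.prems have m: "m = Pre" and y: "\<Delta> y = Some (Pre, c)" and T: "ssp \<Sigma> \<Delta> T d" by auto
    then have yk: "y \<noteq> k" using SP.prems(4) by auto
    from PArg SP.prems(6) yk obtain T' where 
      T': "hsub_sp (sk_sty a) N k T = Some T'" and S': "S' = PArg (drop_var k y) T'"
      by auto
    have Q1t: "stm \<Sigma> \<Delta> (ren_tm (inst y) Q) d"
      by (rule stm_ren(1)[OF _ Q]) (use m y in \<open>auto simp: sren_def inst_def cons_ctx_def split: nat.splits\<close>)
    from hsub_ren(1)[OF sub_ren_compat_inst[OF yk], of "sk_sty a" N Q] Q'
    have Q2: "hsub_tm (sk_sty a) N k (ren_tm (inst y) Q) = Some (ren_tm (inst (drop_var k y)) Q')" by simp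
    have "hsub_tm (sk_sty a) N k R = reduce T' (sk_sty d) (ren_tm (inst (drop_var k y)) Q')"
      by (rule SP.IH(2)[OF _ T Q1t SP.prems(4,5) T' Q2]) (use SP.prems PArg P m in simp_all)
    then show ?thesis using S' Q' m by simp
  qed
qed

lemma del_ctx_shift:
  "j \<le> k \<Longrightarrow> (\<lambda>i. del_ctx j \<Delta> (i + Suc k)) = (\<lambda>i. \<Delta> (i + Suc (Suc k)))"
  "j \<le> k \<Longrightarrow> del_ctx j \<Delta> k = \<Delta> (Suc k)"
  "j < k \<Longrightarrow> del_ctx k \<Delta> j = \<Delta> j"
  by (auto simp: del_ctx_def)

lemma del_ctx_tail: "(\<lambda>i. del_ctx (Suc (j + l)) \<Delta> (i + Suc j)) = del_ctx l (\<lambda>i. \<Delta> (i + Suc j))"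
  by (auto simp: del_ctx_def)

text \<open>Only the heads \<open>y\<close> and \<open>x\<close> need work: there one side has
  already reduced while the other still has to substitute into the reduct, and
  \<open>hsub_reduce_step\<close> exchanges the two operations. All other cases follow the structure
  of the term.\<close>

lemma hsub_comm_step:
  assumes comm: "\<And>c a'. size c + size a' < size b + size a \<Longrightarrow> hsub_comm \<Sigma> c a'"
  shows "stm \<Sigma> \<Delta> M s \<Longrightarrow> \<Delta> j = Some (Ord, b) \<Longrightarrow>
     \<Delta> (Suc (j + l)) = Some (Ord, a) \<Longrightarrow> stm \<Sigma> (\<lambda>i. \<Delta> (i + Suc j)) P b \<Longrightarrow>
     stm \<Sigma> (\<lambda>i. \<Delta> (i + Suc (Suc (j + l)))) N a \<Longrightarrow>
     hsub_tm (sk_sty b) P j M = Some M1 \<Longrightarrow> hsub_tm (sk_sty a) N (Suc (j + l)) M = Some M2 \<Longrightarrow>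
     hsub_tm (sk_sty a) N l P = Some P' \<Longrightarrow>
     hsub_tm (sk_sty a) N (j + l) M1 = hsub_tm (sk_sty b) P' j M2"
   and "ssp \<Sigma> \<Delta> S s \<Longrightarrow> \<Delta> j = Some (Ord, b) \<Longrightarrow>
     \<Delta> (Suc (j + l)) = Some (Ord, a) \<Longrightarrow> stm \<Sigma> (\<lambda>i. \<Delta> (i + Suc j)) P b \<Longrightarrow>
     stm \<Sigma> (\<lambda>i. \<Delta> (i + Suc (Suc (j + l)))) N a \<Longrightarrow>
     hsub_sp (sk_sty b) P j S = Some S1 \<Longrightarrow> hsub_sp (sk_sty a) N (Suc (j + l)) S = Some S2 \<Longrightarrow>
     hsub_tm (sk_sty a) N l P = Some P' \<Longrightarrow>
     hsub_sp (sk_sty a) N (j + l) S1 = hsub_sp (sk_sty b) P' j S2"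
proof (induction M and S arbitrary: \<Delta> j s M1 M2 and \<Delta> j s S1 S2)
  case (App h S)
  note D = App.prems(2,3) and P = App.prems(4) and N = App.prems(5)
  from App.prems(1) obtain e where e: "shead \<Sigma> \<Delta> h e" "ssp \<Sigma> \<Delta> S e" by auto
  from hsub_stm(2)[OF e(2) D(1) refl P] obtain S1 where
    S1: "hsub_sp (sk_sty b) P j S = Some S1" "ssp \<Sigma> (del_ctx j \<Delta>) S1 e" by auto
  from hsub_stm(2)[OF e(2) D(2) refl N] obtain S2 where
    S2: "hsub_sp (sk_sty a) N (Suc (j + l)) S = Some S2" "ssp \<Sigma> (del_ctx (Suc (j + l)) \<Delta>) S2 e" by auto
  have IH: "hsub_sp (sk_sty a) N (j + l) S1 = hsub_sp (sk_sty b) P' j S2"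
    by (rule App.IH[OF e(2) D P N S1(1) S2(1) App.prems(8)])
  have D1: "del_ctx j \<Delta> (j + l) = Some (Ord, a)" using D by (simp add: del_ctx_shift)
  have N1: "stm \<Sigma> (\<lambda>i. del_ctx j \<Delta> (i + Suc (j + l))) N a" using N unfolding del_ctx_shift(1)[OF le_add1] .
  have D2: "del_ctx (Suc (j + l)) \<Delta> j = Some (Ord, b)" using D by (simp add: del_ctx_shift)
  have P2: "stm \<Sigma> (\<lambda>i. del_ctx (Suc (j + l)) \<Delta> (i + Suc j)) P' b"
    using hsub_stm(1)[OF P, of l a "sk_sty a" N] D(2) N App.prems(8)
    unfolding del_ctx_tail by (simp add: add.commute add.left_commute)
  from hsub_stm(2)[OF S1(2) D1 refl N1] obtain S3 where
    S3: "hsub_sp (sk_sty a) N (j + l) S1 = Some S3" by auto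
  consider "h = Var j" | "h = Var (Suc (j + l))" | "h \<noteq> Var j" "h \<noteq> Var (Suc (j + l))" by blast
  then show ?case
  proof cases
    case 1
    then have "e = b" using e D by simp
    have Pj: "stm \<Sigma> (del_ctx j \<Delta>) (ren_tm (\<lambda>i. i + j) P) b"
      by (rule stm_ren(1)[OF _ P]) (auto simp: sren_def del_ctx_def)
    have "sub_ren_compat (\<lambda>i. i + j) (\<lambda>i. i + j) (\<lambda>i. i) l (j + l)"
      by (auto simp: sub_ren_compat_def drop_var_def)
    from hsub_ren(1)[OF this, of "sk_sty a" N P] App.prems(8)
    have P'j: "hsub_tm (sk_sty a) N (j + l) (ren_tm (\<lambda>i. i + j) P) = Some (ren_tm (\<lambda>i. i + j) P')" by simp
    have "hsub_tm (sk_sty a) N (j + l) M1 = reduce S3 (sk_sty b) (ren_tm (\<lambda>i. i + j) P')"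
      by (rule hsub_reduce_step[OF comm order_refl _ Pj D1 N1 S3 P'j])
        (use S1 App.prems(6) 1 \<open>e = b\<close> in \<open>simp_all\<close>)
    moreover have "M2 = App (Var j) S2" using App.prems(7) S2 1 by (auto simp: drop_var_def)
    ultimately show ?thesis using IH[symmetric] S3 by simp
  next
    case 2
    then have "e = a" using e D by simp
    have Nj: "stm \<Sigma> (del_ctx (Suc (j + l)) \<Delta>) (ren_tm (\<lambda>i. i + Suc (j + l)) N) a"
      by (rule stm_ren(1)[OF _ N]) (auto simp: sren_def del_ctx_def)
    \<comment> \<open>\<open>N\<close> lives outside \<open>y\<close>, so substituting for
      \<open>y\<close> in the weakened \<open>N\<close> only renumbers it.\<close>
    have "hsub_tm (sk_sty b) P' j (ren_tm (\<lambda>i. i + Suc (j + l)) N)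
        = Some (ren_tm (drop_var j \<circ> (\<lambda>i. i + Suc (j + l))) N)"
      by (rule hsub_avoid) simp
    moreover have "drop_var j \<circ> (\<lambda>i. i + Suc (j + l)) = (\<lambda>i. i + (j + l))"
      by (auto simp: drop_var_def)
    ultimately have N'j: "hsub_tm (sk_sty b) P' j (ren_tm (\<lambda>i. i + Suc (j + l)) N)
        = Some (ren_tm (\<lambda>i. i + (j + l)) N)" by simp
    \<comment> \<open>Here the reduction lemma is used with the roles of \<open>a\<close> and
      \<open>b\<close> exchanged, which is why the measure is the symmetric sum of the
      sizes.\<close>
    have "hsub_tm (sk_sty b) P' j M2 = reduce S3 (sk_sty a) (ren_tm (\<lambda>i. i + (j + l)) N)"
      by (rule hsub_reduce_step[OF comm eq_refl[OF add.commute] _ Nj D2 P2 _ N'j])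
        (use S2 S3 IH App.prems(7) 2 \<open>e = a\<close> in \<open>simp_all\<close>)
    moreover have "M1 = App (Var (j + l)) S1" using App.prems(6) S1 2 by (auto simp: drop_var_def)
    ultimately show ?thesis using IH[symmetric] S3 by simp
  next
    case 3
    have M: "M1 = App (ren_head (drop_var j) h) S1" "M2 = App (ren_head (drop_var (Suc (j + l))) h) S2"
      using App.prems(6,7) S1 S2 3 by auto
    have "ren_head (drop_var j) h \<noteq> Var (j + l)" "ren_head (drop_var (Suc (j + l))) h \<noteq> Var j"
      "ren_head (drop_var (j + l)) (ren_head (drop_var j) h) =
       ren_head (drop_var j) (ren_head (drop_var (Suc (j + l))) h)"
      using 3 by (cases h; auto simp: drop_var_def)+
    then show ?thesis using M IH by simp
  qed
next
  case (Lam M)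
  then obtain m c d where M: "stm \<Sigma> (cons_ctx (m, c) \<Delta>) M d" by auto
  from Lam.prems obtain M1' M2' where "M1 = Lam M1'" "hsub_tm (sk_sty b) P (Suc j) M = Some M1'"
    "M2 = Lam M2'" "hsub_tm (sk_sty a) N (Suc (Suc j + l)) M = Some M2'" by auto
  with Lam.IH[OF M, of "Suc j" M1' M2'] Lam.prems show ?case by simp
next
  case SNil
  then show ?case by simp
next
  case (Arg M S)
  then obtain c d where M: "stm \<Sigma> \<Delta> M c" "ssp \<Sigma> \<Delta> S d" by auto
  from Arg.prems(6) obtain M1 T1 where 1: "S1 = Arg M1 T1" "hsub_tm (sk_sty b) P j M = Some M1"
    "hsub_sp (sk_sty b) P j S = Some T1" by (auto split: bind_splits)
  from Arg.prems(7) obtain M2 T2 where 2: "S2 = Arg M2 T2" "hsub_tm (sk_sty a) N (Suc (j + l)) M = Some M2"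
    "hsub_sp (sk_sty a) N (Suc (j + l)) S = Some T2" by (auto split: bind_splits)
  show ?case
    using Arg.IH(1)[OF M(1) Arg.prems(2-5) 1(2) 2(2) Arg.prems(8)]
      Arg.IH(2)[OF M(2) Arg.prems(2-5) 1(3) 2(3) Arg.prems(8)] 1 2 by simp
next
  case (PArg y S)
  then obtain c d where y: "\<Delta> y = Some (Pre, c)" and S: "ssp \<Sigma> \<Delta> S d" by auto
  then have ne: "y \<noteq> j" "y \<noteq> Suc (j + l)" using PArg.prems(2,3) by auto
  from PArg.prems(6) ne obtain T1 where 1: "S1 = PArg (drop_var j y) T1"
    "hsub_sp (sk_sty b) P j S = Some T1" by auto
  from PArg.prems(7) ne obtain T2 where 2: "S2 = PArg (drop_var (Suc (j + l)) y) T2"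
    "hsub_sp (sk_sty a) N (Suc (j + l)) S = Some T2" by auto
  have "drop_var j y \<noteq> j + l" "drop_var (Suc (j + l)) y \<noteq> j"
    "drop_var (j + l) (drop_var j y) = drop_var j (drop_var (Suc (j + l)) y)"
    using ne by (auto simp: drop_var_def)
  then show ?case
    using PArg.IH[OF S PArg.prems(2-5) 1(2) 2(2) PArg.prems(8)] 1 2 by simp
qed

lemma hsub_comm: "hsub_comm \<Sigma> b a"
proof (induction "size b + size a" arbitrary: b a rule: less_induct)
  case less
  have "hsub_comm \<Sigma> c a'" if "size c + size a' < size b + size a" for c a'
    using less that by blast
  from hsub_comm_step(1)[OF this] show ?case unfolding hsub_comm_def by blast
qed

lemmas hsub_sp_comm = hsub_comm_step(2)[OF hsub_comm]

lemma hsub_ty_comm: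
  "sty_ok \<Sigma> \<Delta> A \<Longrightarrow> \<Delta> j = Some (Ord, b) \<Longrightarrow>
     \<Delta> (Suc (j + l)) = Some (Ord, a) \<Longrightarrow> stm \<Sigma> (\<lambda>i. \<Delta> (i + Suc j)) P b \<Longrightarrow>
     stm \<Sigma> (\<lambda>i. \<Delta> (i + Suc (Suc (j + l)))) N a \<Longrightarrow>
     hsub_ty (sk_sty b) P j A = Some A1 \<Longrightarrow> hsub_ty (sk_sty a) N (Suc (j + l)) A = Some A2 \<Longrightarrow>
     hsub_tm (sk_sty a) N l P = Some P' \<Longrightarrow>
     hsub_ty (sk_sty a) N (j + l) A1 = hsub_ty (sk_sty b) P' j A2"
proof (induction A arbitrary: \<Delta> j A1 A2)
  case (Atom c S)
  then obtain K where "ssp \<Sigma> \<Delta> S (kskel K)" by auto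
  from hsub_sp_comm[OF this Atom.prems(2-5) _ _ Atom.prems(8)] Atom.prems(6,7) show ?case by auto
next
  case (Pi m A B)
  from Pi.prems(6) obtain A1' B1 where 1: "A1 = Pi m A1' B1" "hsub_ty (sk_sty b) P j A = Some A1'"
    "hsub_ty (sk_sty b) P (Suc j) B = Some B1" by (auto split: bind_splits)
  from Pi.prems(7) obtain A2' B2 where 2: "A2 = Pi m A2' B2" "hsub_ty (sk_sty a) N (Suc (j + l)) A = Some A2'"
    "hsub_ty (sk_sty a) N (Suc (Suc j + l)) B = Some B2" by (auto split: bind_splits)
  show ?case using Pi.IH(1)[OF _ Pi.prems(2-5) 1(2) 2(2) Pi.prems(8)]
    Pi.IH(2)[of "cons_ctx (m, skel A) \<Delta>" "Suc j", OF _ _ _ _ _ 1(3) 2(3) Pi.prems(8)]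
    Pi.prems(1-5) 1 2 by simp
qed

subsection \<open>Contexts and simple typing of well-typed terms\<close>

definition skel_ctx :: "ctx \<Rightarrow> sctx" where
  "skel_ctx \<Gamma> i = (if i < length \<Gamma> then Some (fst (\<Gamma> ! i), skel (snd (\<Gamma> ! i))) else None)"

lemma skel_ctx_Nil [simp]: "skel_ctx [] = Map.empty"
  by (auto simp: skel_ctx_def)

lemma skel_ctx_Cons [simp]: "skel_ctx ((m, A) # \<Gamma>) = cons_ctx (m, skel A) (skel_ctx \<Gamma>)"
proof
  show "skel_ctx ((m, A) # \<Gamma>) i = cons_ctx (m, skel A) (skel_ctx \<Gamma>) i" for i
    by (cases i) (auto simp: skel_ctx_def)
qed

primrec sctx_ok :: "signat \<Rightarrow> ctx \<Rightarrow> bool" where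
  "sctx_ok \<Sigma> [] \<longleftrightarrow> True"
| "sctx_ok \<Sigma> (v # \<Gamma>) \<longleftrightarrow> sty_ok \<Sigma> (skel_ctx \<Gamma>) (snd v) \<and> sctx_ok \<Sigma> \<Gamma>"

lemma in_ctx_skel: "in_ctx \<Gamma> i m A \<Longrightarrow> skel_ctx \<Gamma> i = Some (m, skel A)"
  by (auto simp: in_ctx_def skel_ctx_def)

lemma in_ctx_sty_ok:
  assumes "sctx_ok \<Sigma> \<Gamma>" "in_ctx \<Gamma> i m A"
  shows "sty_ok \<Sigma> (skel_ctx \<Gamma>) A"
proof -
  from assms(2) obtain A0 where A0: "i < length \<Gamma>" "\<Gamma> ! i = (m, A0)" "A = ren_ty (\<lambda>j. j + Suc i) A0"
    by (auto simp: in_ctx_def)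
  have "sty_ok \<Sigma> (skel_ctx (drop (Suc i) \<Gamma>)) A0"
    using assms(1) A0(1,2) by (induction \<Gamma> arbitrary: i) (auto simp: less_Suc_eq_0_disj)
  moreover have "sren (\<lambda>j. j + Suc i) (skel_ctx (drop (Suc i) \<Gamma>)) (skel_ctx \<Gamma>)"
    using A0(1) by (auto simp: sren_def skel_ctx_def add.commute)
  ultimately show ?thesis using sty_ok_ren A0(3) by blast
qed

lemma head_ty_shead:
  "set \<Xi> \<subseteq> set \<Sigma> \<Longrightarrow> head_ty \<Xi> \<Sigma> p \<Gamma> h A \<Longrightarrow> shead \<Sigma> (skel_ctx \<Gamma>) h (skel A)"
  by (erule head_ty.cases, cases p) (auto dest!: in_ctx_skel, (cases p; auto)+)

text \<open>Everything that full typing does to types, namely conversion, substitution and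
  instantiation by a variable, leaves their skeletons unchanged.\<close>

lemma check_stm:
  assumes "set \<Xi> \<subseteq> set \<Sigma>"
  shows "check \<Xi> \<Sigma> p \<Gamma> M A \<Longrightarrow> stm \<Sigma> (skel_ctx \<Gamma>) M (skel A)"
    and "synth \<Xi> \<Sigma> p \<Gamma> R P \<Longrightarrow> stm \<Sigma> (skel_ctx \<Gamma>) R SB"
    and "spine \<Xi> \<Sigma> p \<Gamma> S B Q \<Longrightarrow> ssp \<Sigma> (skel_ctx \<Gamma>) S (skel B)"
proof (induction rule: check_synth_spine.inducts)
  case (synth_app \<Gamma> h A S P)
  then show ?case using head_ty_shead[OF assms] by fastforce
next
  case (spine_parg \<Gamma> y A2' A2 S A1 P)
  then show ?case using in_ctx_skel skel_ty_eq by fastforce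
qed (auto dest: skel_hsub)

lemma kspine_ssp:
  "set \<Xi> \<subseteq> set \<Sigma> \<Longrightarrow> kspine \<Xi> \<Sigma> p \<Gamma> S K L \<Longrightarrow> ssp \<Sigma> (skel_ctx \<Gamma>) S (kskel K)"
  by (rotate_tac, induction rule: kspine.induct)
    (fastforce dest: in_ctx_skel skel_ty_eq check_stm kskel_hsub)+

lemma ty_ok_sty_ok: "set \<Xi> \<subseteq> set \<Sigma> \<Longrightarrow> ty_ok \<Xi> \<Sigma> p \<Gamma> A L \<Longrightarrow> sty_ok \<Sigma> (skel_ctx \<Gamma>) A"
  by (rotate_tac, induction rule: ty_ok.induct) (auto dest: kspine_ssp)

lemma ctx_ok_sctx_ok: "set \<Xi> \<subseteq> set \<Sigma> \<Longrightarrow> ctx_ok \<Xi> \<Sigma> p \<Gamma> \<Longrightarrow> sctx_ok \<Sigma> \<Gamma>"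
  by (rotate_tac, induction rule: ctx_ok.induct) (auto dest: ty_ok_sty_ok)

lemma spine_sty_ok:
  assumes "set \<Xi> \<subseteq> set \<Sigma>"
  shows "spine \<Xi> \<Sigma> p \<Gamma> S A P \<Longrightarrow> sty_ok \<Sigma> (skel_ctx \<Gamma>) A \<Longrightarrow> sty_ok \<Sigma> (skel_ctx \<Gamma>) P"
proof (induction S arbitrary: A rule: sp_induct)
  case SNil
  then show ?case by (auto elim: spine.cases)
next
  case (Arg M S)
  from Arg.prems(1) obtain A2 A1 A1' where A: "A = Pi Ord A2 A1" "check \<Xi> \<Sigma> p \<Gamma> M A2"
    "hsub_ty (erase A2) M 0 A1 = Some A1'" "spine \<Xi> \<Sigma> p \<Gamma> S A1' P" by (auto elim: spine.cases)
  have "sty_ok \<Sigma> (skel_ctx \<Gamma>) A1'"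
    using hsub_sty_ok[of \<Sigma> "cons_ctx (Ord, skel A2) (skel_ctx \<Gamma>)" A1 0 "skel A2" M]
      A check_stm(1)[OF assms A(2)] Arg.prems(2) by (auto simp: erase_skel)
  then show ?case using Arg.IH A by blast
next
  case (PArg y S)
  from PArg.prems(1) obtain A2 A1 A2' where A: "A = Pi Pre A2 A1" "in_ctx \<Gamma> y Pre A2'" "ty_eq \<Sigma> A2' A2"
    "spine \<Xi> \<Sigma> p \<Gamma> S (ren_ty (inst y) A1) P" by (auto elim: spine.cases)
  have "sren (inst y) (cons_ctx (Pre, skel A2) (skel_ctx \<Gamma>)) (skel_ctx \<Gamma>)"
    using in_ctx_skel[OF A(2)] skel_ty_eq[OF A(3)] by (intro sren_inst) simp
  from sty_ok_ren[OF this] have "sty_ok \<Sigma> (skel_ctx \<Gamma>) (ren_ty (inst y) A1)"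
    using A PArg.prems(2) by simp
  then show ?case using PArg.IH A by blast
qed

subsection \<open>Unfoldings\<close>

inductive_simps sp_rel_simps [simp]:
  "sp_rel R SNil Ts" "sp_rel R (Arg M S) Ts" "sp_rel R (PArg y S) Ts"

inductive_cases unfolds_LamE: "unfolds \<Sigma> (Lam M) T"
inductive_cases unfolds_AppE: "unfolds \<Sigma> (App h S) T"

lemma sp_rel_weaken:
  "sp_rel R S Ts \<Longrightarrow> (\<And>M T. R M T \<Longrightarrow> R' M T) \<Longrightarrow> sp_rel R' S Ts"
  using sp_rel_mono by blast

lemma unfolds_AppD:
  assumes "unfolds \<Sigma> (App h S) T"
  obtains h' S' Ts where "T = BApp h' Ts" "sp_rel (unfolds \<Sigma>) S' Ts" "\<not> is_Rec h'"
    "(h' = h \<and> S' = S) \<or> (\<exists>r A M. h = Rec r \<and> DRec r A M \<in> set \<Sigma> \<and> reduce S (erase A) M = Some (App h' S'))"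
  using assms by (elim unfolds_AppE) blast+

primrec sk_prepattern :: "sk \<Rightarrow> bool" where
  "sk_prepattern SB \<longleftrightarrow> True"
| "sk_prepattern (SP m a b) \<longleftrightarrow> m = Pre \<and> sk_prepattern b"

lemma prepattern_skel: "prepattern_ty A \<Longrightarrow> sk_prepattern (skel A)"
  by (induction A) auto

lemma contractive_ren: "contractive (ren_tm f M) = contractive M"
  by (induction M arbitrary: f rule: contractive.induct) auto

text \<open>A prepattern spine triggers renamings only, and these never change whether a head is a
  recursion constant. An ordinary argument could be substituted for the head and expose one.\<close>

lemma contractive_reduce:
  "reduce S \<sigma> M = Some R \<Longrightarrow> contractive M \<Longrightarrow> ssp \<Sigma> \<Delta> S a \<Longrightarrow> sk_prepattern a \<Longrightarrow> contractive R"
proof (induction S arbitrary: \<sigma> M a rule: sp_induct)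
  case SNil
  then show ?case by (cases \<sigma>; cases M) auto
next
  case (PArg y S)
  from PArg.prems(1) obtain \<tau> M0 where M0: "M = Lam M0" "\<sigma> = Arr Base \<tau>"
    "reduce S \<tau> (ren_tm (inst y) M0) = Some R"
    by (cases \<sigma>; cases M; cases "case \<sigma> of Arr x _ \<Rightarrow> x") auto
  from PArg.prems(3,4) obtain b where "ssp \<Sigma> \<Delta> S b" "sk_prepattern b" by auto
  then show ?case using PArg.IH[OF M0(3)] PArg.prems(2) M0(1) by (simp add: contractive_ren)
qed auto

section \<open>Renaming of trees and construction of the tree of a term\<close>

primrec ren_barg :: "(nat \<Rightarrow> nat) \<Rightarrow> 'a barg \<Rightarrow> 'a barg" where
  "ren_barg f (BArg T) = BArg T"
| "ren_barg f (BPArg y) = BPArg (f y)"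

text \<open>Variable arguments are renamed by \<open>ren_barg\<close> and subtrees by
  \<open>map_barg\<close>, so that the corecursive call passes through map functions as
  \<open>primcorec\<close> requires.\<close>

primcorec ren_btree :: "(nat \<Rightarrow> nat) \<Rightarrow> btree \<Rightarrow> btree" where
  "ren_btree f T = (case T of
     BApp h Ts \<Rightarrow> BApp (ren_head f h) (map (map_barg (ren_btree f)) (map (ren_barg f) Ts))
   | BLam T' \<Rightarrow> BLam (ren_btree (up f) T'))"

lemma ren_btree_simps [simp]:
  "ren_btree f (BApp h Ts) = BApp (ren_head f h) (map (map_barg (ren_btree f) \<circ> ren_barg f) Ts)"
  "ren_btree f (BLam T) = BLam (ren_btree (up f) T)"
  by (subst ren_btree.code; simp)+

lemma sp_rel_ren:
  "sp_rel R S Ts \<Longrightarrow>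
     sp_rel (\<lambda>M' T'. \<exists>M T. M' = ren_tm f M \<and> T' = ren_btree f T \<and> R M T)
       (ren_sp f S) (map (map_barg (ren_btree f) \<circ> ren_barg f) Ts)"
  by (induction rule: sp_rel.induct) auto

primrec sp_bargs :: "sp \<Rightarrow> tm barg list" where
  "sp_bargs SNil = []"
| "sp_bargs (Arg M S) = BArg M # sp_bargs S"
| "sp_bargs (PArg y S) = BPArg y # sp_bargs S"

text \<open>A total function is needed for corecursion, hence the choice operator. On simply typed
  arguments in a well-formed signature the chosen pair exists and is unique, as shown in
  \<open>unfolds_btree_of\<close>.\<close>

definition head_unfold :: "signat \<Rightarrow> head \<Rightarrow> sp \<Rightarrow> head \<times> sp" where
  "head_unfold \<Sigma> h S = (if is_Rec h
     then SOME (h', S'). \<exists>r A M. h = Rec r \<and> DRec r A M \<in> set \<Sigma> \<and> reduce S (erase A) M = Some (App h' S') \<and>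
       \<not> is_Rec h'
     else (h, S))"

primrec tm_view :: "signat \<Rightarrow> tm \<Rightarrow> head \<times> sp + tm" where
  "tm_view \<Sigma> (App h S) = Inl (head_unfold \<Sigma> h S)"
| "tm_view \<Sigma> (Lam M) = Inr M"

primcorec btree_of :: "signat \<Rightarrow> tm \<Rightarrow> btree" where
  "btree_of \<Sigma> M = (case tm_view \<Sigma> M of
     Inl v \<Rightarrow> BApp (fst v) (map (map_barg (btree_of \<Sigma>)) (sp_bargs (snd v)))
   | Inr M' \<Rightarrow> BLam (btree_of \<Sigma> M'))"

lemma btree_of_simps [simp]:
  "btree_of \<Sigma> (App h S) = BApp (fst (head_unfold \<Sigma> h S))
       (map (map_barg (btree_of \<Sigma>)) (sp_bargs (snd (head_unfold \<Sigma> h S))))"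
  "btree_of \<Sigma> (Lam M) = BLam (btree_of \<Sigma> M)"
  by (subst btree_of.code; simp)+

lemma sp_rel_btree_of:
  "ssp \<Sigma> \<Delta> S a \<Longrightarrow> sp_rel (\<lambda>M T. \<exists>\<Delta> s. stm \<Sigma> \<Delta> M s \<and> T = btree_of \<Sigma> M) S (map (map_barg (btree_of \<Sigma>)) (sp_bargs S))"
  by (induction S arbitrary: a rule: sp_induct) auto

text \<open>Inductive, so an occurrence lies at a finite depth of the possibly infinite tree.
  Absence has to be expressed on trees because the tree is all that two equal terms share.\<close>

inductive occ :: "nat \<Rightarrow> btree \<Rightarrow> bool" where
  occ_head: "occ k (BApp (Var k) Ts)"
| occ_arg: "BArg T \<in> set Ts \<Longrightarrow> occ k T \<Longrightarrow> occ k (BApp h Ts)"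
| occ_parg: "BPArg k \<in> set Ts \<Longrightarrow> occ k (BApp h Ts)"
| occ_lam: "occ (Suc k) T \<Longrightarrow> occ k (BLam T)"

inductive_simps occ_BApp: "occ k (BApp h Ts)"

lemma sp_rel_BArg:
  "sp_rel R S Ts \<Longrightarrow> ssp \<Sigma> \<Delta> S a \<Longrightarrow> BArg T \<in> set Ts \<Longrightarrow> \<exists>M s. R M T \<and> stm \<Sigma> \<Delta> M s"
  by (induction arbitrary: a rule: sp_rel.induct) auto

lemma sp_rel_BPArg:
  "sp_rel R S Ts \<Longrightarrow> ssp \<Sigma> \<Delta> S a \<Longrightarrow> BPArg y \<in> set Ts \<Longrightarrow> \<Delta> y \<noteq> None"
  by (induction arbitrary: a rule: sp_rel.induct) auto

lemma cons_ctx_upd: "(cons_ctx v \<Delta>)(Suc k := None) = cons_ctx v (\<Delta>(k := None))"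
proof
  show "((cons_ctx v \<Delta>)(Suc k := None)) i = cons_ctx v (\<Delta>(k := None)) i" for i
    by (cases i) auto
qed

text \<open>All arguments of such a spine are variables of mode \<open>Pre\<close>, hence different
  from \<open>k\<close>, which has mode \<open>Ord\<close>.\<close>

lemma ssp_prepattern_upd:
  "ssp \<Sigma> \<Delta> S a \<Longrightarrow> sk_prepattern a \<Longrightarrow> \<Delta> k = Some (Ord, b) \<Longrightarrow> ssp \<Sigma> (\<Delta>(k := None)) S a"
  by (induction S arbitrary: a rule: sp_induct) auto

definition tm_eq :: "signat \<Rightarrow> tm \<Rightarrow> tm \<Rightarrow> bool" where
  "tm_eq \<Sigma> M M' \<longleftrightarrow> (\<exists>T. unfolds \<Sigma> M T \<and> unfolds \<Sigma> M' T)"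

lemma tm_eq_Lam: "tm_eq \<Sigma> (Lam M) (Lam M') \<longleftrightarrow> tm_eq \<Sigma> M M'"
  unfolding tm_eq_def by (auto elim!: unfolds_LamE intro: unfolds.intros)

lemma tm_eq_App:
  "\<not> is_Rec h \<Longrightarrow> \<not> is_Rec h' \<Longrightarrow> tm_eq \<Sigma> (App h S) (App h' S') \<longleftrightarrow> h = h' \<and> sp_eq \<Sigma> S S'"
  unfolding tm_eq_def sp_eq_def by (fastforce elim!: unfolds_AppE intro: unfolds.intros)

lemma sp_eq_Arg: "sp_eq \<Sigma> (Arg M S) (Arg M' S') \<longleftrightarrow> tm_eq \<Sigma> M M' \<and> sp_eq \<Sigma> S S'"
  unfolding sp_eq_def tm_eq_def by auto

lemma sp_eq_PArg: "sp_eq \<Sigma> (PArg y S) (PArg y' S') \<longleftrightarrow> y = y' \<and> sp_eq \<Sigma> S S'"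
  unfolding sp_eq_def by auto

lemma sp_eq_shape:
  "sp_eq \<Sigma> SNil S' \<Longrightarrow> S' = SNil"
  "sp_eq \<Sigma> (Arg M S) S' \<Longrightarrow> \<exists>M' S''. S' = Arg M' S''"
  "sp_eq \<Sigma> (PArg y S) S' \<Longrightarrow> \<exists>S''. S' = PArg y S''"
  unfolding sp_eq_def by (cases S'; auto)+

section \<open>Consequences of well-formedness of the signature\<close>

locale colf_sig =
  fixes \<Sigma> :: signat
  assumes sig_ok: "sig_ok \<Sigma>"
begin

lemma decl_unique: "d \<in> set \<Sigma> \<Longrightarrow> d' \<in> set \<Sigma> \<Longrightarrow> decl_name d = decl_name d' \<Longrightarrow> d = d'"
  using sig_ok by (auto simp: sig_ok_def distinct_map inj_on_def)

lemma decl_ok_prefix: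
  assumes "d \<in> set \<Sigma>"
  obtains \<Xi> where "set \<Xi> \<subseteq> set \<Sigma>" "decl_ok \<Xi> \<Sigma> d"
proof -
  from split_list[OF assms] obtain \<Xi> \<Omega> where "\<Sigma> = \<Xi> @ d # \<Omega>" by blast
  then show thesis using sig_ok that[of \<Xi>] by (auto simp: sig_ok_def)
qed

lemma DCon_sty_ok: "DCon c A \<in> set \<Sigma> \<Longrightarrow> sty_ok \<Sigma> Map.empty A"
  by (erule decl_ok_prefix) (auto dest!: ty_ok_sty_ok)

lemma DRec_ok:
  assumes "DRec r A M \<in> set \<Sigma>"
  shows "sty_ok \<Sigma> Map.empty A" "sk_prepattern (skel A)" "contractive M" "stm \<Sigma> Map.empty M (skel A)"
proof -
  from decl_ok_prefix[OF assms] obtain \<Xi> where \<Xi>: "set \<Xi> \<subseteq> set \<Sigma>" "decl_ok \<Xi> \<Sigma> (DRec r A M)" .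
  then show "sty_ok \<Sigma> Map.empty A" using ty_ok_sty_ok[OF \<Xi>(1)] by fastforce
  show "stm \<Sigma> Map.empty M (skel A)" using check_stm(1)[OF \<Xi>(1)] \<Xi>(2) by fastforce
  show "sk_prepattern (skel A)" "contractive M" using \<Xi> prepattern_skel by auto
qed

text \<open>This provides the unfolding step: the reduct exists because the body is simply typed,
  and its head is not a recursion constant because the body is contractive and the spine a
  prepattern spine.\<close>

lemma reduce_rec:
  assumes r: "DRec r A M \<in> set \<Sigma>" and S: "ssp \<Sigma> \<Delta> S (skel A)"
  obtains h S' where "reduce S (erase A) M = Some (App h S')" "\<not> is_Rec h" "stm \<Sigma> \<Delta> (App h S') SB"
proof -
  have "stm \<Sigma> \<Delta> M (skel A)"
    using stm_ren(1)[OF _ DRec_ok(4)[OF r], of "\<lambda>i. i" \<Delta>] by simp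
  from hsub_stm(3)[OF S this refl] obtain R where R: "reduce S (erase A) M = Some R" "stm \<Sigma> \<Delta> R SB"
    by (auto simp: erase_skel)
  then obtain h S' where "R = App h S'" by (cases R) auto
  with contractive_reduce[OF R(1) DRec_ok(3)[OF r] S DRec_ok(2)[OF r]] R that show thesis by auto
qed

lemma DRec_unique: "DRec r A M \<in> set \<Sigma> \<Longrightarrow> DRec r A' M' \<in> set \<Sigma> \<Longrightarrow> A' = A \<and> M' = M"
  using decl_unique[of "DRec r A M" "DRec r A' M'"] by simp

text \<open>Bodies of recursive definitions are closed, so renaming the spine of a recursion
  constant renames the reduct, and each node is kept.\<close>

lemma unfolds_ren:
  "unfolds \<Sigma> M T \<Longrightarrow> unfolds \<Sigma> (ren_tm f M) (ren_btree f T)"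
proof (coinduction arbitrary: f M T rule: unfolds.coinduct)
  case unfolds
  then show ?case
  proof (cases rule: unfolds.cases)
    case (unfolds_lam M T)
    then show ?thesis by auto
  next
    case (unfolds_app h S Ts)
    have "sp_rel (\<lambda>M' T'. (\<exists>f M T. M' = ren_tm f M \<and> T' = ren_btree f T \<and> unfolds \<Sigma> M T) \<or> unfolds \<Sigma> M' T')
        (ren_sp f S) (map (map_barg (ren_btree f) \<circ> ren_barg f) Ts)"
      by (rule sp_rel_weaken[OF sp_rel_ren[OF unfolds_app(4)]]) blast
    with unfolds_app show ?thesis by simp
  next
    case (unfolds_rec r A M0 S h S' Ts)
    have "reduce (ren_sp f S) (erase A) M0 = Some (App (ren_head f h) (ren_sp f S'))"
      using hsub_ren(3)[of f S "erase A" M0] unfolds_rec(4) closed_ren(1)[OF DRec_ok(4)[OF unfolds_rec(3)]] by simp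
    moreover have "sp_rel (\<lambda>M' T'. (\<exists>f M T. M' = ren_tm f M \<and> T' = ren_btree f T \<and> unfolds \<Sigma> M T) \<or> unfolds \<Sigma> M' T')
        (ren_sp f S') (map (map_barg (ren_btree f) \<circ> ren_barg f) Ts)"
      by (rule sp_rel_weaken[OF sp_rel_ren[OF unfolds_rec(6)]]) blast
    ultimately show ?thesis using unfolds_rec by (intro disjI2) (simp, blast)
  qed
qed

lemma tm_eq_ren: "tm_eq \<Sigma> M M' \<Longrightarrow> tm_eq \<Sigma> (ren_tm f M) (ren_tm f M')"
  unfolding tm_eq_def using unfolds_ren by blast

text \<open>\<open>Con []\<close> serves as a dummy head that turns a spine into a term;
  \<open>unfolds\<close> only asks that a head not be a recursion constant. The same device wraps
  argument trees in \<open>not_occ_upd\<close>.\<close>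

lemma sp_eq_ren: "sp_eq \<Sigma> S S' \<Longrightarrow> sp_eq \<Sigma> (ren_sp f S) (ren_sp f S')"
  using tm_eq_ren[of "App (Con []) S" "App (Con []) S'"] by (simp add: tm_eq_App)

lemma unfolds_btree_of: "stm \<Sigma> \<Delta> M s \<Longrightarrow> unfolds \<Sigma> M (btree_of \<Sigma> M)"
proof (coinduction arbitrary: \<Delta> M s rule: unfolds.coinduct)
  case unfolds
  show ?case
  proof (cases M)
    case (Lam M0)
    then show ?thesis using unfolds by auto
  next
    case (App h S)
    then obtain a where a: "shead \<Sigma> \<Delta> h a" "ssp \<Sigma> \<Delta> S a" using unfolds by auto
    have rel: "sp_rel (\<lambda>M T. (\<exists>\<Delta> M' s. M = M' \<and> T = btree_of \<Sigma> M' \<and> stm \<Sigma> \<Delta> M' s) \<or> unfolds \<Sigma> M T)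
        S' (map (map_barg (btree_of \<Sigma>)) (sp_bargs S'))" if "ssp \<Sigma> \<Delta> S' b" for S' b
      by (rule sp_rel_weaken[OF sp_rel_btree_of[OF that]]) blast
    show ?thesis
    proof (cases "is_Rec h")
      case False
      then have "head_unfold \<Sigma> h S = (h, S)" by (simp add: head_unfold_def)
      then show ?thesis using App False rel[OF a(2)] by simp
    next
      case True
      then obtain r where r: "h = Rec r" by (cases h) auto
      with a obtain A M0 where A: "DRec r A M0 \<in> set \<Sigma>" "a = skel A" by auto
      from reduce_rec[OF A(1)] a(2) A(2) obtain h' S' where
        hS: "reduce S (erase A) M0 = Some (App h' S')" "\<not> is_Rec h'" "stm \<Sigma> \<Delta> (App h' S') SB" by metis
      \<comment> \<open>Uniqueness of the declaration of \<open>r\<close> pins down the pair chosen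
        in \<open>head_unfold\<close>.\<close>
      have "(\<exists>r A M. h = Rec r \<and> DRec r A M \<in> set \<Sigma> \<and> reduce S (erase A) M = Some (App h'' S'') \<and>
          \<not> is_Rec h'') \<longleftrightarrow> h'' = h' \<and> S'' = S'" for h'' S''
      proof
        assume "\<exists>r A M. h = Rec r \<and> DRec r A M \<in> set \<Sigma> \<and> reduce S (erase A) M = Some (App h'' S'') \<and>
          \<not> is_Rec h''"
        then obtain A' M' where "DRec r A' M' \<in> set \<Sigma>" "reduce S (erase A') M' = Some (App h'' S'')"
          using r by auto
        then show "h'' = h' \<and> S'' = S'" using DRec_unique[OF A(1)] hS(1) by auto
      qed (use r A(1) hS in blast)
      then have "head_unfold \<Sigma> h S = (h', S')"
        unfolding head_unfold_def using True by simp (rule some_equality, auto)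
      moreover from hS(3) obtain b where "ssp \<Sigma> \<Delta> S' b" by auto
      ultimately show ?thesis using App r A(1) hS(1,2) rel[of S' b]
        by (intro disjI2 exI[of _ r] exI[of _ A] exI[of _ M0] exI[of _ S] exI[of _ h'] exI[of _ S'])
          simp
    qed
  qed
qed

lemma tm_eq_refl: "stm \<Sigma> \<Delta> M s \<Longrightarrow> tm_eq \<Sigma> M M"
  unfolding tm_eq_def using unfolds_btree_of by blast

lemma sp_eq_refl: "ssp \<Sigma> \<Delta> S s \<Longrightarrow> sp_eq \<Sigma> S S"
  by (induction S arbitrary: s rule: sp_induct)
    (auto simp: sp_eq_Arg sp_eq_PArg tm_eq_refl, auto simp: sp_eq_def)

lemma sp_rel_det:
  "sp_rel R S Ts \<Longrightarrow> sp_rel R S Ts' \<Longrightarrow>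
     list_all2 (rel_barg (\<lambda>T T'. \<exists>M. R M T \<and> R M T')) Ts Ts'"
  by (induction arbitrary: Ts' rule: sp_rel.induct) auto

text \<open>The only freedom in \<open>unfolds\<close> is the declaration used for a recursion
  constant, and distinctness of names removes it. No typing is involved.\<close>

lemma unfolds_det: "unfolds \<Sigma> M T \<Longrightarrow> unfolds \<Sigma> M T' \<Longrightarrow> T = T'"
proof (coinduction arbitrary: M T T' rule: btree.coinduct_strong)
  case Eq_btree
  show ?case
  proof (cases M)
    case (Lam M0)
    then show ?thesis using Eq_btree by (auto elim!: unfolds_LamE)
  next
    case (App h S)
    from Eq_btree(1)[unfolded App] obtain h1 S1 Ts1 where 1: "T = BApp h1 Ts1" "sp_rel (unfolds \<Sigma>) S1 Ts1"
      "\<not> is_Rec h1" "(h1 = h \<and> S1 = S) \<or>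
       (\<exists>r A M. h = Rec r \<and> DRec r A M \<in> set \<Sigma> \<and> reduce S (erase A) M = Some (App h1 S1))"
      by (rule unfolds_AppD)
    from Eq_btree(2)[unfolded App] obtain h2 S2 Ts2 where 2: "T' = BApp h2 Ts2" "sp_rel (unfolds \<Sigma>) S2 Ts2"
      "\<not> is_Rec h2" "(h2 = h \<and> S2 = S) \<or>
       (\<exists>r A M. h = Rec r \<and> DRec r A M \<in> set \<Sigma> \<and> reduce S (erase A) M = Some (App h2 S2))"
      by (rule unfolds_AppD)
    from 1 2 have "h2 = h1 \<and> S2 = S1" using DRec_unique by fastforce
    with 1 2 have "\<exists>h' S' Ts Ts'. T = BApp h' Ts \<and> T' = BApp h' Ts' \<and> sp_rel (unfolds \<Sigma>) S' Ts \<and>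
      sp_rel (unfolds \<Sigma>) S' Ts'" by blast
    then obtain h' S' Ts Ts' where "T = BApp h' Ts" "T' = BApp h' Ts'"
      "list_all2 (rel_barg (\<lambda>T T'. \<exists>M. unfolds \<Sigma> M T \<and> unfolds \<Sigma> M T')) Ts Ts'"
      using sp_rel_det by blast
    then show ?thesis
      by (auto elim!: list.rel_mono_strong barg.rel_mono_strong)
  qed
qed

lemma sp_rel_unfolds_det:
  assumes "sp_rel (unfolds \<Sigma>) S Ts" "sp_rel (unfolds \<Sigma>) S Ts'" shows "Ts = Ts'"
proof -
  have "unfolds \<Sigma> (App (Con []) S) (BApp (Con []) Ts)" "unfolds \<Sigma> (App (Con []) S) (BApp (Con []) Ts')"
    using assms by (auto intro: unfolds.intros)
  from unfolds_det[OF this] show ?thesis by simp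
qed

section \<open>Type equality as an equivalence relation\<close>

lemma sp_eq_trans: "sp_eq \<Sigma> S S' \<Longrightarrow> sp_eq \<Sigma> S' S'' \<Longrightarrow> sp_eq \<Sigma> S S''"
  unfolding sp_eq_def using sp_rel_unfolds_det by metis

lemma ty_eq_trans: "ty_eq \<Sigma> A B \<Longrightarrow> ty_eq \<Sigma> B C \<Longrightarrow> ty_eq \<Sigma> A C"
  by (induction arbitrary: C rule: ty_eq.induct)
    (auto elim!: ty_eq.cases[of \<Sigma> "Atom _ _"] ty_eq.cases[of \<Sigma> "Pi _ _ _"] intro!: ty_eq.intros intro: sp_eq_trans)

lemma ty_eq_sym: "ty_eq \<Sigma> A B \<Longrightarrow> ty_eq \<Sigma> B A"
  by (induction rule: ty_eq.induct) (auto intro!: ty_eq.intros simp: sp_eq_def)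

lemma ty_eq_refl: "sty_ok \<Sigma> \<Delta> A \<Longrightarrow> ty_eq \<Sigma> A A"
  by (induction A arbitrary: \<Delta>) (auto intro!: ty_eq.intros intro: sp_eq_refl)

lemma ty_eq_ren: "ty_eq \<Sigma> A B \<Longrightarrow> ty_eq \<Sigma> (ren_ty f A) (ren_ty f B)"
  by (induction arbitrary: f rule: ty_eq.induct) (auto intro!: ty_eq.intros sp_eq_ren)

text \<open>Whether or not the head had to be unfolded, the subtrees of a node come from a spine
  that is simply typed in the same context. This lets inductions on trees follow the typing.\<close>

lemma unfolds_BApp:
  assumes "unfolds \<Sigma> M (BApp h Ts)" "stm \<Sigma> \<Delta> M s"
  shows "\<exists>S a. shead \<Sigma> \<Delta> h a \<and> ssp \<Sigma> \<Delta> S a \<and> sp_rel (unfolds \<Sigma>) S Ts"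
  using assms(1)
proof (cases rule: unfolds.cases)
  case (unfolds_app S)
  then show ?thesis using assms(2) by auto
next
  case (unfolds_rec r A M0 S S')
  from assms(2) unfolds_rec(1) obtain A' M' where "DRec r A' M' \<in> set \<Sigma>" "ssp \<Sigma> \<Delta> S (skel A')" by auto
  then have "ssp \<Sigma> \<Delta> S (skel A)" using DRec_unique[OF unfolds_rec(2)] by auto
  from reduce_rec[OF unfolds_rec(2) this] unfolds_rec(3) have "stm \<Sigma> \<Delta> (App h S') SB" by auto
  then show ?thesis using unfolds_rec(5) by auto
qed

lemma occ_in_ctx:
  "occ k T \<Longrightarrow> unfolds \<Sigma> M T \<Longrightarrow> stm \<Sigma> \<Delta> M s \<Longrightarrow> \<Delta> k \<noteq> None"
proof (induction arbitrary: M \<Delta> s rule: occ.induct)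
  case (occ_lam k T)
  from occ_lam.prems(1) obtain M0 where M0: "M = Lam M0" "unfolds \<Sigma> M0 T" by (auto elim: unfolds.cases)
  with occ_lam.prems(2) obtain m a b where "stm \<Sigma> (cons_ctx (m, a) \<Delta>) M0 b" by auto
  from occ_lam.IH[OF M0(2) this] show ?case by simp
next
  case (occ_head k Ts)
  from unfolds_BApp[OF occ_head] show ?case by auto
next
  case (occ_arg T Ts k h)
  from unfolds_BApp[OF occ_arg.prems] obtain S a where S: "ssp \<Sigma> \<Delta> S a" "sp_rel (unfolds \<Sigma>) S Ts" by auto
  from sp_rel_BArg[OF S(2,1) occ_arg.hyps(1)] occ_arg.IH show ?case by blast
next
  case (occ_parg k Ts h)
  from unfolds_BApp[OF occ_parg.prems] obtain S a where S: "ssp \<Sigma> \<Delta> S a" "sp_rel (unfolds \<Sigma>) S Ts" by auto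
  from sp_rel_BPArg[OF S(2,1) occ_parg.hyps(1)] show ?case .
qed

subsection \<open>Hereditary substitution respects equality of unfoldings\<close>

text \<open>A converse of \<open>occ_in_ctx\<close> for ordinary variables. The induction is on the
  finite term: at a recursion constant nothing has to be unfolded, since its prepattern spine cannot
  mention \<open>k\<close> anyway.\<close>

lemma not_occ_upd:
  "unfolds \<Sigma> M T \<Longrightarrow> \<not> occ k T \<Longrightarrow> stm \<Sigma> \<Delta> M s \<Longrightarrow> \<Delta> k = Some (Ord, a) \<Longrightarrow> stm \<Sigma> (\<Delta>(k := None)) M s"
  "sp_rel (unfolds \<Sigma>) S Ts \<Longrightarrow> \<not> occ k (BApp (Con []) Ts) \<Longrightarrow> ssp \<Sigma> \<Delta> S s \<Longrightarrow> \<Delta> k = Some (Ord, a) \<Longrightarrow>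
     ssp \<Sigma> (\<Delta>(k := None)) S s"
proof (induction M and S arbitrary: T k \<Delta> s and Ts k \<Delta> s)
  case (App h S)
  from App.prems(3) obtain b where b: "s = SB" "shead \<Sigma> \<Delta> h b" "ssp \<Sigma> \<Delta> S b" by auto
  show ?case
  proof (cases "is_Rec h")
    case True
    then obtain r where r: "h = Rec r" by (cases h) auto
    with b obtain A M where A: "DRec r A M \<in> set \<Sigma>" "b = skel A" by auto
    then have "sk_prepattern b" using DRec_ok(2) by blast
    from ssp_prepattern_upd[OF b(3) this App.prems(4)] show ?thesis
      using b(1) r A unfolding stm.simps by (auto simp del: fun_upd_apply)
  next
    case False
    with App.prems(1) obtain Ts where T: "T = BApp h Ts" "sp_rel (unfolds \<Sigma>) S Ts"
      by (auto elim!: unfolds_AppE)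
    with App.prems(2) have "h \<noteq> Var k" "\<not> occ k (BApp (Con []) Ts)"
      by (auto simp: occ_BApp)
    moreover from this(1) have "shead \<Sigma> (\<Delta>(k := None)) h b" using b(2) by (cases h) auto
    ultimately show ?thesis using App.IH[OF T(2) _ b(3) App.prems(4)] b(1)
      by (auto simp del: fun_upd_apply)
  qed
next
  case (Lam M)
  from Lam.prems(1) obtain T' where T: "T = BLam T'" "unfolds \<Sigma> M T'" by (auto elim: unfolds_LamE)
  from Lam.prems(3) obtain m c d where s: "s = SP m c d" "stm \<Sigma> (cons_ctx (m, c) \<Delta>) M d" by auto
  have "stm \<Sigma> ((cons_ctx (m, c) \<Delta>)(Suc k := None)) M d"
    by (rule Lam.IH[OF T(2) _ s(2)]) (use Lam.prems(2,4) T(1) in \<open>auto intro: occ.intros\<close>)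
  then show ?case using s(1) by (simp add: cons_ctx_upd del: fun_upd_apply)
next
  case SNil
  then show ?case by simp
next
  case (Arg M S)
  from Arg.prems(1) obtain T Ts' where T: "Ts = BArg T # Ts'" "unfolds \<Sigma> M T" "sp_rel (unfolds \<Sigma>) S Ts'" by auto
  from Arg.prems(3) obtain c d where s: "s = SP Ord c d" "stm \<Sigma> \<Delta> M c" "ssp \<Sigma> \<Delta> S d" by auto
  have "\<not> occ k T" "\<not> occ k (BApp (Con []) Ts')" using Arg.prems(2) T(1)
    by (auto simp: occ_BApp)
  then show ?case
    using Arg.IH(1)[OF T(2) _ s(2) Arg.prems(4)] Arg.IH(2)[OF T(3) _ s(3) Arg.prems(4)] s(1)
    by (auto simp del: fun_upd_apply)
next
  case (PArg y S)
  from PArg.prems(1) obtain Ts' where T: "Ts = BPArg y # Ts'" "sp_rel (unfolds \<Sigma>) S Ts'" by auto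
  from PArg.prems(3) obtain c d where s: "s = SP Pre c d" "\<Delta> y = Some (Pre, c)" "ssp \<Sigma> \<Delta> S d" by auto
  have "\<not> occ k (BApp (Con []) Ts')" using PArg.prems(2) T(1)
    by (auto simp: occ_BApp)
  then show ?case
    using PArg.IH[OF T(2) _ s(3) PArg.prems(4)] s PArg.prems(4) by auto
qed

text \<open>The substituted term varies as well, although typing substitutes a single
  \<open>N\<close>: inside \<open>reduce\<close> the arguments of the two spines are merely
  equal.\<close>

definition hsub_respects :: "sk \<Rightarrow> bool" where
  "hsub_respects a \<longleftrightarrow> (\<forall>\<Delta> M M' s k N N' R R'. stm \<Sigma> \<Delta> M s \<longrightarrow> stm \<Sigma> \<Delta> M' s \<longrightarrow> tm_eq \<Sigma> M M' \<longrightarrow>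
     \<Delta> k = Some (Ord, a) \<longrightarrow> stm \<Sigma> (\<lambda>i. \<Delta> (i + Suc k)) N a \<longrightarrow> stm \<Sigma> (\<lambda>i. \<Delta> (i + Suc k)) N' a \<longrightarrow>
     tm_eq \<Sigma> N N' \<longrightarrow> hsub_tm (sk_sty a) N k M = Some R \<longrightarrow> hsub_tm (sk_sty a) N' k M' = Some R' \<longrightarrow>
     tm_eq \<Sigma> R R')"

lemma hsub_respectsD:
  assumes "hsub_respects a" and "stm \<Sigma> \<Delta> M s" and "stm \<Sigma> \<Delta> M' s" and "tm_eq \<Sigma> M M'"
    and "\<Delta> k = Some (Ord, a)" and "stm \<Sigma> (\<lambda>i. \<Delta> (i + Suc k)) N a" and "stm \<Sigma> (\<lambda>i. \<Delta> (i + Suc k)) N' a"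
    and "tm_eq \<Sigma> N N'" and "hsub_tm (sk_sty a) N k M = Some R" and "hsub_tm (sk_sty a) N' k M' = Some R'"
  shows "tm_eq \<Sigma> R R'"
  using assms unfolding hsub_respects_def by blast

text \<open>Inner induction on \<open>b\<close>: the argument of a contracted binder has a skeleton
  strictly smaller than \<open>b\<close>, hence smaller than \<open>a\<close>, where
  \<open>hyp\<close> applies.\<close>

lemma reduce_respects:
  assumes hyp: "\<And>c. size c < size a \<Longrightarrow> hsub_respects c"
  shows "size b \<le> size a \<Longrightarrow> ssp \<Sigma> \<Delta> S b \<Longrightarrow> ssp \<Sigma> \<Delta> S' b \<Longrightarrow> sp_eq \<Sigma> S S' \<Longrightarrow>
    stm \<Sigma> \<Delta> P b \<Longrightarrow> stm \<Sigma> \<Delta> P' b \<Longrightarrow> tm_eq \<Sigma> P P' \<Longrightarrow>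
    reduce S (sk_sty b) P = Some R \<Longrightarrow> reduce S' (sk_sty b) P' = Some R' \<Longrightarrow> tm_eq \<Sigma> R R'"
proof (induction b arbitrary: S S' P P')
  case SB
  then have "S = SNil" "S' = SNil" by (cases S; cases S'; simp)+
  moreover from SB.prems(5,6) obtain h Q h' Q' where "P = App h Q" "P' = App h' Q'" by (cases P; cases P') auto
  ultimately show ?case using SB.prems by simp
next
  case (SP m c d)
  from SP.prems(5,6) obtain Q Q' where P: "P = Lam Q" "P' = Lam Q'"
    and Q: "stm \<Sigma> (cons_ctx (m, c) \<Delta>) Q d" "stm \<Sigma> (cons_ctx (m, c) \<Delta>) Q' d" by (cases P; cases P') auto
  from SP.prems(7) P have QQ: "tm_eq \<Sigma> Q Q'" by (simp add: tm_eq_Lam)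
  show ?case
  proof (cases S)
    case SNil
    then show ?thesis using SP.prems by simp
  next
    case (Arg X T)
    with SP.prems(4) obtain X' T' where S': "S' = Arg X' T'" using sp_eq_shape by blast
    from Arg S' SP.prems have m: "m = Ord" and X: "stm \<Sigma> \<Delta> X c" "stm \<Sigma> \<Delta> X' c" "tm_eq \<Sigma> X X'"
      and T: "ssp \<Sigma> \<Delta> T d" "ssp \<Sigma> \<Delta> T' d" "sp_eq \<Sigma> T T'" by (auto simp: sp_eq_Arg)
    from hsub_stm(1)[OF Q(1)[unfolded m], of 0 c "sk_sty c" X] X obtain Y where
      Y: "hsub_tm (sk_sty c) X 0 Q = Some Y" "stm \<Sigma> \<Delta> Y d" by auto
    from hsub_stm(1)[OF Q(2)[unfolded m], of 0 c "sk_sty c" X'] X obtain Y' where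
      Y': "hsub_tm (sk_sty c) X' 0 Q' = Some Y'" "stm \<Sigma> \<Delta> Y' d" by auto
    have "hsub_respects c" using SP.prems(1) by (intro hyp) simp
    from hsub_respectsD[OF this Q[unfolded m] QQ _ _ _ X(3) Y(1) Y'(1)] X
    have "tm_eq \<Sigma> Y Y'" by simp
    from SP.IH(2)[OF _ T Y(2) Y'(2) this] show ?thesis
      using SP.prems(1,8,9) Arg S' P m Y(1) Y'(1) by simp
  next
    case (PArg y T)
    with SP.prems(4) obtain T' where S': "S' = PArg y T'" using sp_eq_shape by blast
    from PArg S' SP.prems have m: "m = Pre" and y: "\<Delta> y = Some (Pre, c)" 
      and T: "ssp \<Sigma> \<Delta> T d" "ssp \<Sigma> \<Delta> T' d" "sp_eq \<Sigma> T T'" by (auto simp: sp_eq_PArg)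
    note ri = stm_ren(1)[OF sren_inst[of \<Delta> y, OF y]]
    from SP.IH(2)[OF _ T ri[OF Q(1)[unfolded m]] ri[OF Q(2)[unfolded m]] tm_eq_ren[OF QQ]] show ?thesis
      using SP.prems(1,8,9) PArg S' P m by simp
  qed
qed

text \<open>
  A term headed by a recursion constant has only prepattern variables in its spine, so the
  substituted variable does not occur in its tree; by equality of trees it does not occur in the
  other term either, and both substitutions are mere renumberings.
\<close>

lemma hsub_respects_rec:
  assumes "stm \<Sigma> \<Delta> (App (Rec r) S) s" "stm \<Sigma> \<Delta> M' s'" "tm_eq \<Sigma> (App (Rec r) S) M'" "\<Delta> k = Some (Ord, a)"
    and "hsub_tm \<tau> N k (App (Rec r) S) = Some R" and "hsub_tm \<tau>' N' k M' = Some R'"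
  shows "tm_eq \<Sigma> R R'"
proof -
  from assms(3) obtain T where T: "unfolds \<Sigma> (App (Rec r) S) T" "unfolds \<Sigma> M' T" by (auto simp: tm_eq_def)
  from assms(1) obtain A M where A: "DRec r A M \<in> set \<Sigma>" "ssp \<Sigma> \<Delta> S (skel A)" by auto
  have M1: "stm \<Sigma> (\<Delta>(k := None)) (App (Rec r) S) s"
    using ssp_prepattern_upd[OF A(2) DRec_ok(2)[OF A(1)] assms(4)] A(1) assms(1)
    by (auto simp del: fun_upd_apply)
  have "\<not> occ k T" using occ_in_ctx[OF _ T(1) M1, of k] by auto
  from not_occ_upd(1)[OF T(2) this assms(2,4)] have M2: "stm \<Sigma> (\<Delta>(k := None)) M' s'" .
  have "R = ren_tm (drop_var k) (App (Rec r) S)" "R' = ren_tm (drop_var k) M'"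
    using hsub_unused[OF M1, of k \<tau> N] hsub_unused[OF M2, of k \<tau>' N'] assms(5,6) by auto
  then show ?thesis using tm_eq_ren assms(3) by blast
qed

lemma tm_eq_sym: "tm_eq \<Sigma> M M' \<Longrightarrow> tm_eq \<Sigma> M' M"
  by (auto simp: tm_eq_def)

lemma hsub_respects_step:
  assumes hyp: "\<And>c. size c < size a \<Longrightarrow> hsub_respects c"
  shows "stm \<Sigma> \<Delta> M s \<Longrightarrow> stm \<Sigma> \<Delta> M' s \<Longrightarrow> tm_eq \<Sigma> M M' \<Longrightarrow>
     \<Delta> k = Some (Ord, a) \<Longrightarrow> stm \<Sigma> (\<lambda>i. \<Delta> (i + Suc k)) N a \<Longrightarrow> stm \<Sigma> (\<lambda>i. \<Delta> (i + Suc k)) N' a \<Longrightarrow>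
     tm_eq \<Sigma> N N' \<Longrightarrow> hsub_tm (sk_sty a) N k M = Some R \<Longrightarrow> hsub_tm (sk_sty a) N' k M' = Some R' \<Longrightarrow>
     tm_eq \<Sigma> R R'"
  and "ssp \<Sigma> \<Delta> S s \<Longrightarrow> ssp \<Sigma> \<Delta> S' s \<Longrightarrow> sp_eq \<Sigma> S S' \<Longrightarrow>
     \<Delta> k = Some (Ord, a) \<Longrightarrow> stm \<Sigma> (\<lambda>i. \<Delta> (i + Suc k)) N a \<Longrightarrow> stm \<Sigma> (\<lambda>i. \<Delta> (i + Suc k)) N' a \<Longrightarrow>
     tm_eq \<Sigma> N N' \<Longrightarrow> hsub_sp (sk_sty a) N k S = Some U \<Longrightarrow> hsub_sp (sk_sty a) N' k S' = Some U' \<Longrightarrow>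
     sp_eq \<Sigma> U U'"
proof (induction M and S arbitrary: M' \<Delta> s k R R' and S' \<Delta> s k U U')
  case (App h S)
  note D = App.prems(4) and N = App.prems(5,6,7)
  from App.prems(1) have [simp]: "s = SB" by auto
  from App.prems(2) obtain h' S' where M': "M' = App h' S'" by (cases M') auto
  \<comment> \<open>If either head is a recursion constant, both substitutions are renumberings.
    Otherwise no unfolding takes place at the root, so the heads coincide and the spines are
    equal.\<close>
  consider "is_Rec h" | "is_Rec h'" | "\<not> is_Rec h" "\<not> is_Rec h'" by blast
  then show ?case
  proof cases
    case 1
    then obtain r where h: "h = Rec r" by (cases h) auto
    show ?thesis
      by (rule hsub_respects_rec[OF App.prems(1)[unfolded h] App.prems(2) App.prems(3)[unfolded h] D
            App.prems(8)[unfolded h] App.prems(9)])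
  next
    case 2
    then obtain r' where h': "h' = Rec r'" by (cases h') auto
    have "tm_eq \<Sigma> R' R"
      by (rule hsub_respects_rec[OF App.prems(2)[unfolded M' h'] App.prems(1)
            tm_eq_sym[OF App.prems(3)[unfolded M' h']] D App.prems(9)[unfolded M' h'] App.prems(8)])
    then show ?thesis by (rule tm_eq_sym)
  next
    case 3
    with App.prems(3) M' have h: "h' = h" and SS: "sp_eq \<Sigma> S S'" by (auto simp: tm_eq_App)
    from App.prems(1) obtain b where b: "shead \<Sigma> \<Delta> h b" "ssp \<Sigma> \<Delta> S b" by auto
    from App.prems(2) M' h obtain b' where b': "shead \<Sigma> \<Delta> h b'" "ssp \<Sigma> \<Delta> S' b'" by auto
    \<comment> \<open>Both spines belong to the same head; for a constructor, its skeleton is unique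
      because its declaration is.\<close>
    have bb: "b' = b"
      using b(1) b'(1) 3 by (cases h) (auto dest: decl_unique)
    from hsub_stm(2)[OF b(2) D refl N(1)] obtain U where
      U: "hsub_sp (sk_sty a) N k S = Some U" "ssp \<Sigma> (del_ctx k \<Delta>) U b" by auto
    from hsub_stm(2)[OF b'(2) D refl N(2)] bb obtain U' where
      U': "hsub_sp (sk_sty a) N' k S' = Some U'" "ssp \<Sigma> (del_ctx k \<Delta>) U' b" by auto
    have UU: "sp_eq \<Sigma> U U'" by (rule App.IH[OF b(2) _ SS D N U(1) U'(1)]) (use b' bb in simp)
    show ?thesis
    proof (cases "h = Var k")
      case True
      with b D have ba: "b = a" by auto
      have "sren (\<lambda>i. i + k) (\<lambda>i. \<Delta> (i + Suc k)) (del_ctx k \<Delta>)" by (auto simp: sren_def del_ctx_def)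
      note rk = stm_ren(1)[OF this]
      show ?thesis
        by (rule reduce_respects[OF hyp order_refl _ _ UU rk[OF N(1)] rk[OF N(2)] tm_eq_ren[OF N(3)]])
          (use U U' ba App.prems(8,9) M' h True in simp_all)
    next
      case False
      then have "R = App (ren_head (drop_var k) h) U" "R' = App (ren_head (drop_var k) h) U'"
        using App.prems(8,9) M' h U U' by auto
      then show ?thesis using UU 3 by (simp add: tm_eq_App)
    qed
  qed
next
  case (Lam M)
  from Lam.prems(1) obtain m c d where s: "s = SP m c d" "stm \<Sigma> (cons_ctx (m, c) \<Delta>) M d" by auto
  from Lam.prems(2) s obtain M0 where M0: "M' = Lam M0" "stm \<Sigma> (cons_ctx (m, c) \<Delta>) M0 d" by (cases M') auto
  from Lam.prems(3) M0 have "tm_eq \<Sigma> M M0" by (simp add: tm_eq_Lam)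
  moreover from Lam.prems(8,9) M0 obtain Q Q' where Q: "R = Lam Q" "R' = Lam Q'"
    "hsub_tm (sk_sty a) N (Suc k) M = Some Q" "hsub_tm (sk_sty a) N' (Suc k) M0 = Some Q'" by auto
  ultimately have "tm_eq \<Sigma> Q Q'"
    using Lam.prems(4-7) by (intro Lam.IH[OF s(2) M0(2) _ _ _ _ _ Q(3,4)]) simp_all
  then show ?case using Q by (simp add: tm_eq_Lam)
next
  case SNil
  then have "S' = SNil" using sp_eq_shape by blast
  then show ?case using SNil by simp
next
  case (Arg M S)
  from sp_eq_shape(2)[OF Arg.prems(3)] obtain M0 S0 where S': "S' = Arg M0 S0" by blast
  from Arg.prems(1-3) S' obtain c d where s: "stm \<Sigma> \<Delta> M c" "stm \<Sigma> \<Delta> M0 c" "tm_eq \<Sigma> M M0"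
    "ssp \<Sigma> \<Delta> S d" "ssp \<Sigma> \<Delta> S0 d" "sp_eq \<Sigma> S S0" by (auto simp: sp_eq_Arg)
  from Arg.prems(8) obtain M1 S1 where U: "U = Arg M1 S1" "hsub_tm (sk_sty a) N k M = Some M1"
    "hsub_sp (sk_sty a) N k S = Some S1" by (auto split: bind_splits)
  from Arg.prems(9) S' obtain M2 S2 where U': "U' = Arg M2 S2" "hsub_tm (sk_sty a) N' k M0 = Some M2"
    "hsub_sp (sk_sty a) N' k S0 = Some S2" by (auto split: bind_splits)
  show ?case
    using Arg.IH(1)[OF s(1-3) Arg.prems(4-7) U(2) U'(2)] Arg.IH(2)[OF s(4-6) Arg.prems(4-7) U(3) U'(3)]
      U U' by (simp add: sp_eq_Arg)
next
  case (PArg y S)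
  from sp_eq_shape(3)[OF PArg.prems(3)] obtain S0 where S': "S' = PArg y S0" by blast
  from PArg.prems(1-3) S' obtain c d where s: "\<Delta> y = Some (Pre, c)"
    "ssp \<Sigma> \<Delta> S d" "ssp \<Sigma> \<Delta> S0 d" "sp_eq \<Sigma> S S0" by (auto simp: sp_eq_PArg)
  then have "y \<noteq> k" using PArg.prems(4) by auto
  with PArg.prems(8,9) S' obtain S1 S2 where U: "U = PArg (drop_var k y) S1" "hsub_sp (sk_sty a) N k S = Some S1"
    "U' = PArg (drop_var k y) S2" "hsub_sp (sk_sty a) N' k S0 = Some S2" by auto
  show ?case using PArg.IH[OF s(2-4) PArg.prems(4-7) U(2,4)] U by (simp add: sp_eq_PArg)
qed

lemma hsub_respects: "hsub_respects a"
proof (induction "size a" arbitrary: a rule: less_induct)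
  case less
  from hsub_respects_step(1)[OF less] show ?case unfolding hsub_respects_def by blast
qed

lemmas hsub_sp_respects = hsub_respects_step(2)[OF hsub_respects]

lemma hsub_ty_respects:
  "ty_eq \<Sigma> A B \<Longrightarrow> sty_ok \<Sigma> \<Delta> A \<Longrightarrow> sty_ok \<Sigma> \<Delta> B \<Longrightarrow>
   \<Delta> k = Some (Ord, a) \<Longrightarrow> stm \<Sigma> (\<lambda>i. \<Delta> (i + Suc k)) N a \<Longrightarrow>
   hsub_ty (sk_sty a) N k A = Some A' \<Longrightarrow> hsub_ty (sk_sty a) N k B = Some B' \<Longrightarrow> ty_eq \<Sigma> A' B'"
proof (induction arbitrary: \<Delta> k A' B' rule: ty_eq.induct)
  case (ty_eq_atom S S' c)
  from ty_eq_atom.prems(1) obtain K where K: "DFam c K \<in> set \<Sigma>" "ssp \<Sigma> \<Delta> S (kskel K)" by auto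
  from ty_eq_atom.prems(2) obtain K' where K': "DFam c K' \<in> set \<Sigma>" "ssp \<Sigma> \<Delta> S' (kskel K')" by auto
  from K(1) K'(1) have "K' = K" using decl_unique by fastforce
  then have S': "ssp \<Sigma> \<Delta> S' (kskel K)" using K' by simp
  from ty_eq_atom.prems(5,6) obtain U U' where U: "A' = Atom c U" "B' = Atom c U'"
    "hsub_sp (sk_sty a) N k S = Some U" "hsub_sp (sk_sty a) N k S' = Some U'" by auto
  from hsub_sp_respects[OF K(2) S' ty_eq_atom.hyps ty_eq_atom.prems(3,4,4) tm_eq_refl[OF ty_eq_atom.prems(4)] U(3,4)]
  show ?case using U by (auto intro: ty_eq.intros)
next
  case (ty_eq_pi A2 A2' A1 A1' m)
  from ty_eq_pi.prems(5) obtain B2 B1 where B: "A' = Pi m B2 B1" "hsub_ty (sk_sty a) N k A2 = Some B2"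
    "hsub_ty (sk_sty a) N (Suc k) A1 = Some B1" by (auto split: bind_splits)
  from ty_eq_pi.prems(6) obtain C2 C1 where C: "B' = Pi m C2 C1" "hsub_ty (sk_sty a) N k A2' = Some C2"
    "hsub_ty (sk_sty a) N (Suc k) A1' = Some C1" by (auto split: bind_splits)
  have "ty_eq \<Sigma> B2 C2" by (rule ty_eq_pi.IH(1)[OF _ _ ty_eq_pi.prems(3,4) B(2) C(2)]) (use ty_eq_pi.prems in auto)
  moreover have "ty_eq \<Sigma> B1 C1"
    using ty_eq_pi.prems skel_ty_eq[OF ty_eq_pi.hyps(1)]
    by (intro ty_eq_pi.IH(2)[OF _ _ _ _ B(3) C(3), of "cons_ctx (m, skel A2) \<Delta>"]) auto
  ultimately show ?case using B C by (auto intro: ty_eq.intros)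
qed

end

subsection \<open>Typing\<close>

lemma in_ctx_Cons_0: "in_ctx (v # \<Gamma>) 0 m A \<longleftrightarrow> fst v = m \<and> A = ren_ty Suc (snd v)"
  by (cases v) (auto simp: in_ctx_def)

lemma in_ctx_Cons_Suc: "in_ctx (v # \<Gamma>) (Suc i) m A \<longleftrightarrow> (\<exists>B. in_ctx \<Gamma> i m B \<and> A = ren_ty Suc B)"
proof -
  have "Suc \<circ> (\<lambda>j. j + Suc i) = (\<lambda>j. j + Suc (Suc i))" by auto
  then show ?thesis by (auto simp: in_ctx_def ren_ty_comp)
qed

lemma in_ctx_append: "in_ctx \<Gamma> i m A \<Longrightarrow> in_ctx (\<Gamma>' @ \<Gamma>) (i + length \<Gamma>') m (ren_ty (\<lambda>j. j + length \<Gamma>') A)"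
proof -
  have "(\<lambda>j. j + length \<Gamma>') \<circ> (\<lambda>j. j + Suc i) = (\<lambda>j. j + Suc (i + length \<Gamma>'))" by auto
  then show "in_ctx \<Gamma> i m A \<Longrightarrow> ?thesis" by (auto simp: in_ctx_def ren_ty_comp nth_append)
qed

lemma ren_inst_Suc [simp]: "ren_ty (inst y) (ren_ty Suc A) = A"
proof -
  have "inst y \<circ> Suc = (\<lambda>i. i)" by auto
  then show ?thesis by (simp add: ren_ty_comp)
qed

lemma ren_up_Suc: "ren_ty (up f) (ren_ty Suc A) = ren_ty Suc (ren_ty f A)"
proof -
  have "up f \<circ> Suc = Suc \<circ> f" by auto
  then show ?thesis by (simp add: ren_ty_comp)
qed

lemma ren_inst_up: "ren_ty f (ren_ty (inst y) A) = ren_ty (inst (f y)) (ren_ty (up f) A)"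
proof -
  have "f \<circ> inst y = inst (f y) \<circ> up f" by (rule ext) (case_tac x, auto)
  then show ?thesis by (simp add: ren_ty_comp)
qed

lemma skel_ctx_in_ctx: "skel_ctx \<Gamma> i = Some (m, a) \<Longrightarrow> \<exists>A. in_ctx \<Gamma> i m A"
  by (cases "\<Gamma> ! i") (auto simp: skel_ctx_def in_ctx_def split: if_splits)

inductive_cases ty_eq_AtomE: "ty_eq \<Sigma> (Atom a S) A"
inductive_cases ty_eq_PiE: "ty_eq \<Sigma> (Pi m A B) C"

text \<open>Types of variables bound before \<open>x\<close> cannot mention \<open>x\<close> and are
  only renumbered. For those bound after it, substitution commutes with the weakening over each
  later binder, by \<open>sub_ren_compat_Suc\<close>.\<close>

lemma in_ctx_hsub:
  "hsub_ctx \<tau> N \<Gamma>' = Some \<Gamma>'' \<Longrightarrow> in_ctx (\<Gamma>' @ v # \<Gamma>) i m B \<Longrightarrow> i \<noteq> length \<Gamma>' \<Longrightarrow>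
   \<exists>B'. hsub_ty \<tau> N (length \<Gamma>') B = Some B' \<and> in_ctx (\<Gamma>'' @ \<Gamma>) (drop_var (length \<Gamma>') i) m B'"
proof (induction \<Gamma>' arbitrary: \<Gamma>'' i B)
  case Nil
  then obtain j B0 where j: "i = Suc j" "in_ctx \<Gamma> j m B0" "B = ren_ty Suc B0"
    by (cases i) (auto simp: in_ctx_Cons_Suc)
  have "drop_var 0 \<circ> Suc = (\<lambda>i. i)" by (auto simp: drop_var_def)
  then have "hsub_ty \<tau> N 0 B = Some B0" using hsub_ty_avoid[of Suc 0 \<tau> N B0] j(3) by simp
  then show ?case using Nil j by (simp add: drop_var_def)
next
  case (Cons w \<Gamma>')
  obtain m0 C where w: "w = (m0, C)" by (cases w)
  with Cons.prems(1) obtain C' \<Theta> where C': "hsub_ty \<tau> N (length \<Gamma>') C = Some C'"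
    "hsub_ctx \<tau> N \<Gamma>' = Some \<Theta>" "\<Gamma>'' = (m0, C') # \<Theta>" by (auto split: bind_splits)
  note shift = hsub_ty_ren[OF sub_ren_compat_Suc, of \<tau> N "length \<Gamma>'"]
  show ?case
  proof (cases i)
    case 0
    with Cons.prems(2) w have "m = m0" "B = ren_ty Suc C" by (auto simp: in_ctx_Cons_0)
    then show ?thesis using shift[of C] C' 0 by (simp add: in_ctx_Cons_0 drop_var_def)
  next
    case (Suc j)
    with Cons.prems(2) obtain B0 where B0: "in_ctx (\<Gamma>' @ v # \<Gamma>) j m B0" "B = ren_ty Suc B0"
      by (auto simp: in_ctx_Cons_Suc)
    have j: "j \<noteq> length \<Gamma>'" using Suc Cons.prems(3) by simp
    from Cons.IH[OF C'(2) B0(1) j] obtain B' where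
      B': "hsub_ty \<tau> N (length \<Gamma>') B0 = Some B'" "in_ctx (\<Theta> @ \<Gamma>) (drop_var (length \<Gamma>') j) m B'" by blast
    have "drop_var (Suc (length \<Gamma>')) (Suc j) = Suc (drop_var (length \<Gamma>') j)"
      using j by (auto simp: drop_var_def)
    then show ?thesis using shift[of B0] B' B0 Suc C' by (auto simp: in_ctx_Cons_Suc)
  qed
qed

lemma in_ctx_hsub_eq:
  assumes "in_ctx (\<Gamma>' @ (m', A) # \<Gamma>) (length \<Gamma>') m B"
  shows "m = m'" "hsub_ty \<tau> N (length \<Gamma>') B = Some (ren_ty (\<lambda>i. i + length \<Gamma>') A)"
proof -
  let ?k = "length \<Gamma>'"
  have B: "m = m'" "B = ren_ty (\<lambda>j. j + Suc ?k) A" using assms by (auto simp: in_ctx_def)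
  then show "m = m'" by blast
  have "drop_var ?k \<circ> (\<lambda>j. j + Suc ?k) = (\<lambda>i. i + ?k)" by (auto simp: drop_var_def)
  then show "hsub_ty \<tau> N ?k B = Some (ren_ty (\<lambda>i. i + ?k) A)"
    using hsub_ty_avoid[of "\<lambda>j. j + Suc ?k" ?k \<tau> N A] B by simp
qed

lemma skel_ctx_insert:
  "skel_ctx (\<Gamma>' @ (m, A) # \<Gamma>) (length \<Gamma>') = Some (m, skel A)"
  "(\<lambda>i. skel_ctx (\<Gamma>' @ (m, A) # \<Gamma>) (i + Suc (length \<Gamma>'))) = skel_ctx \<Gamma>"
  by (auto simp: skel_ctx_def nth_append)

lemma hsub_ctx_ok:
  "sctx_ok \<Sigma> (\<Gamma>' @ (Ord, A) # \<Gamma>) \<Longrightarrow> stm \<Sigma> (skel_ctx \<Gamma>) N (skel A) \<Longrightarrow>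
   \<exists>\<Gamma>''. hsub_ctx (erase A) N \<Gamma>' = Some \<Gamma>'' \<and> length \<Gamma>'' = length \<Gamma>' \<and> sctx_ok \<Sigma> (\<Gamma>'' @ \<Gamma>) \<and>
     skel_ctx (\<Gamma>'' @ \<Gamma>) = del_ctx (length \<Gamma>') (skel_ctx (\<Gamma>' @ (Ord, A) # \<Gamma>))"
proof (induction \<Gamma>')
  case Nil
  then show ?case by simp
next
  case (Cons v \<Gamma>')
  obtain m C where v: "v = (m, C)" by (cases v)
  from Cons obtain \<Theta> where \<Theta>: "hsub_ctx (erase A) N \<Gamma>' = Some \<Theta>" "length \<Theta> = length \<Gamma>'" "sctx_ok \<Sigma> (\<Theta> @ \<Gamma>)"
     "skel_ctx (\<Theta> @ \<Gamma>) = del_ctx (length \<Gamma>') (skel_ctx (\<Gamma>' @ (Ord, A) # \<Gamma>))" by auto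
  from hsub_sty_ok[of \<Sigma> "skel_ctx (\<Gamma>' @ (Ord, A) # \<Gamma>)" C "length \<Gamma>'" "skel A" N] Cons.prems v
  obtain C' where C': "hsub_ty (erase A) N (length \<Gamma>') C = Some C'" "sty_ok \<Sigma> (skel_ctx (\<Theta> @ \<Gamma>)) C'"
    unfolding skel_ctx_insert \<Theta>(4) by (auto simp: erase_skel)
  then show ?case using \<Theta> v by (simp add: skel_hsub)
qed

section \<open>Typing under renaming, conversion and substitution\<close>

context colf_sig begin

lemma head_ty_sty_ok:
  assumes "set \<Xi> \<subseteq> set \<Sigma>" "sctx_ok \<Sigma> \<Gamma>" "head_ty \<Xi> \<Sigma> p \<Gamma> h A"
  shows "sty_ok \<Sigma> (skel_ctx \<Gamma>) A" "\<not> (\<exists>i. h = Var i) \<Longrightarrow> sty_ok \<Sigma> Map.empty A"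
proof -
  have "(\<exists>i m. in_ctx \<Gamma> i m A \<and> h = Var i) \<or> sty_ok \<Sigma> Map.empty A"
    using assms(3)
  proof (cases rule: head_ty.cases)
    case (2 c)
    then show ?thesis using DCon_sty_ok assms(1) by blast
  next
    case (3 r M)
    then have "DRec r A M \<in> set \<Sigma>" using assms(1) by (cases p) auto
    then show ?thesis using DRec_ok(1) by blast
  qed blast
  then show "sty_ok \<Sigma> (skel_ctx \<Gamma>) A" "\<not> (\<exists>i. h = Var i) \<Longrightarrow> sty_ok \<Sigma> Map.empty A"
    using in_ctx_sty_ok[OF assms(2)] sty_ok_ren[OF sren_empty[of "\<lambda>i. i"], of \<Sigma> A] by auto
qed

definition ctx_ren :: "(nat \<Rightarrow> nat) \<Rightarrow> ctx \<Rightarrow> ctx \<Rightarrow> bool" where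
  "ctx_ren f \<Gamma> \<Gamma>' \<longleftrightarrow>
     (\<forall>i m A. in_ctx \<Gamma> i m A \<longrightarrow> (\<exists>A'. in_ctx \<Gamma>' (f i) m A' \<and> ty_eq \<Sigma> (ren_ty f A) A'))"

lemma ctx_ren_sren: "ctx_ren f \<Gamma> \<Gamma>' \<Longrightarrow> sren f (skel_ctx \<Gamma>) (skel_ctx \<Gamma>')"
  unfolding sren_def
proof (intro allI impI)
  fix i v
  assume *: "ctx_ren f \<Gamma> \<Gamma>'" "skel_ctx \<Gamma> i = Some v"
  obtain m a where v: "v = (m, a)" by (cases v)
  with skel_ctx_in_ctx *(2) obtain A where A: "in_ctx \<Gamma> i m A" by blast
  with *(1) obtain A' where "in_ctx \<Gamma>' (f i) m A'" "ty_eq \<Sigma> (ren_ty f A) A'" unfolding ctx_ren_def by blast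
  with in_ctx_skel[OF A] *(2) show "skel_ctx \<Gamma>' (f i) = Some v"
    using in_ctx_skel skel_ty_eq by fastforce
qed

lemma ctx_ren_up:
  assumes "ctx_ren f \<Gamma> \<Gamma>'" "ty_eq \<Sigma> (ren_ty f A) A'"
  shows "ctx_ren (up f) ((m, A) # \<Gamma>) ((m, A') # \<Gamma>')"
  unfolding ctx_ren_def
proof (intro allI impI)
  fix i m' B
  assume i: "in_ctx ((m, A) # \<Gamma>) i m' B"
  show "\<exists>B'. in_ctx ((m, A') # \<Gamma>') (up f i) m' B' \<and> ty_eq \<Sigma> (ren_ty (up f) B) B'"
  proof (cases i)
    case 0
    then show ?thesis using i assms(2) by (auto simp: in_ctx_Cons_0 ren_up_Suc intro: ty_eq_ren)
  next
    case (Suc j)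
    then obtain C where C: "in_ctx \<Gamma> j m' C" "B = ren_ty Suc C" using i by (auto simp: in_ctx_Cons_Suc)
    then obtain C' where "in_ctx \<Gamma>' (f j) m' C'" "ty_eq \<Sigma> (ren_ty f C) C'" using assms(1) unfolding ctx_ren_def by blast
    then show ?thesis using C Suc by (auto simp: in_ctx_Cons_Suc ren_up_Suc intro: ty_eq_ren)
  qed
qed

lemma ctx_ren_inst:
  assumes "sctx_ok \<Sigma> \<Gamma>" "in_ctx \<Gamma> y m A'" "ty_eq \<Sigma> A' A"
  shows "ctx_ren (inst y) ((m, A) # \<Gamma>) \<Gamma>"
  unfolding ctx_ren_def
proof (intro allI impI)
  fix i m' B
  assume i: "in_ctx ((m, A) # \<Gamma>) i m' B"
  show "\<exists>B'. in_ctx \<Gamma> (inst y i) m' B' \<and> ty_eq \<Sigma> (ren_ty (inst y) B) B'"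
  proof (cases i)
    case 0
    then show ?thesis using i assms(2) ty_eq_sym[OF assms(3)] by (auto simp: in_ctx_Cons_0)
  next
    case (Suc j)
    then show ?thesis using i in_ctx_sty_ok[OF assms(1)] ty_eq_refl by (fastforce simp: in_ctx_Cons_Suc)
  qed
qed

lemma ctx_ren_weaken:
  assumes "sctx_ok \<Sigma> \<Gamma>"
  shows "ctx_ren (\<lambda>i. i + length \<Gamma>') \<Gamma> (\<Gamma>' @ \<Gamma>)"
  unfolding ctx_ren_def
  using in_ctx_append[of \<Gamma> _ _ _ \<Gamma>'] ty_eq_ren ty_eq_refl in_ctx_sty_ok[OF assms] by blast

lemma head_ty_ren:
  assumes "set \<Xi> \<subseteq> set \<Sigma>" "sctx_ok \<Sigma> \<Gamma>" "ctx_ren f \<Gamma> \<Gamma>'" "head_ty \<Xi> \<Sigma> p \<Gamma> h A"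
  shows "\<exists>A'. head_ty \<Xi> \<Sigma> p \<Gamma>' (ren_head f h) A' \<and> ty_eq \<Sigma> (ren_ty f A) A'"
proof (cases "\<exists>i. h = Var i")
  case True
  then obtain i m where "h = Var i" "in_ctx \<Gamma> i m A" using assms(4) by (auto elim: head_ty.cases)
  moreover from this(2) obtain A' where "in_ctx \<Gamma>' (f i) m A'" "ty_eq \<Sigma> (ren_ty f A) A'"
    using assms(3) unfolding ctx_ren_def by blast
  ultimately show ?thesis by (auto intro: head_ty.intros)
next
  case False
  from head_ty_sty_ok(2)[OF assms(1,2,4) this] have "ren_ty f A = A" "ty_eq \<Sigma> A A"
    using closed_ren(2) ty_eq_refl by blast+
  moreover have "head_ty \<Xi> \<Sigma> p \<Gamma>' (ren_head f h) A"
    using assms(4) False by (auto elim!: head_ty.cases intro: head_ty.intros)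
  ultimately show ?thesis by auto
qed

text \<open>
  Renaming and conversion have to be treated together: instantiating a prepattern binder \<open>x ^: A\<close>
  by a variable \<open>y\<close> changes the type of the head \<open>x\<close> to one that is merely equal to \<open>A\<close>.
\<close>

lemma typing_ren_conv:
  assumes \<Xi>: "set \<Xi> \<subseteq> set \<Sigma>"
  shows "check \<Xi> \<Sigma> p \<Gamma> M A \<Longrightarrow> sctx_ok \<Sigma> \<Gamma> \<Longrightarrow> sctx_ok \<Sigma> \<Gamma>' \<Longrightarrow> ctx_ren f \<Gamma> \<Gamma>' \<Longrightarrow>
      sty_ok \<Sigma> (skel_ctx \<Gamma>) A \<Longrightarrow> sty_ok \<Sigma> (skel_ctx \<Gamma>') A' \<Longrightarrow> ty_eq \<Sigma> (ren_ty f A) A' \<Longrightarrow>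
      check \<Xi> \<Sigma> p \<Gamma>' (ren_tm f M) A'"
    and "synth \<Xi> \<Sigma> p \<Gamma> R P \<Longrightarrow> sctx_ok \<Sigma> \<Gamma> \<Longrightarrow> sctx_ok \<Sigma> \<Gamma>' \<Longrightarrow> ctx_ren f \<Gamma> \<Gamma>' \<Longrightarrow>
      \<exists>P'. synth \<Xi> \<Sigma> p \<Gamma>' (ren_tm f R) P' \<and> ty_eq \<Sigma> (ren_ty f P) P'"
    and "spine \<Xi> \<Sigma> p \<Gamma> S B Q \<Longrightarrow> sctx_ok \<Sigma> \<Gamma> \<Longrightarrow> sctx_ok \<Sigma> \<Gamma>' \<Longrightarrow> ctx_ren f \<Gamma> \<Gamma>' \<Longrightarrow>
      sty_ok \<Sigma> (skel_ctx \<Gamma>) B \<Longrightarrow> sty_ok \<Sigma> (skel_ctx \<Gamma>') B' \<Longrightarrow> ty_eq \<Sigma> (ren_ty f B) B' \<Longrightarrow>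
      \<exists>Q'. spine \<Xi> \<Sigma> p \<Gamma>' (ren_sp f S) B' Q' \<and> ty_eq \<Sigma> (ren_ty f Q) Q'"
proof (induction arbitrary: \<Gamma>' f A' and \<Gamma>' f and \<Gamma>' f B' rule: check_synth_spine.inducts)
  case (check_lam m A2 \<Gamma> M A1)
  from check_lam.prems(6) obtain A2' A1' where A': "A' = Pi m A2' A1'" "ty_eq \<Sigma> (ren_ty f A2) A2'"
    "ty_eq \<Sigma> (ren_ty (up f) A1) A1'" by (auto elim: ty_eq_PiE)
  have "check \<Xi> \<Sigma> p ((m, A2') # \<Gamma>') (ren_tm (up f) M) A1'"
    by (rule check_lam.IH(2)[OF _ _ ctx_ren_up[OF check_lam.prems(3) A'(2)] _ _ A'(3)])
      (use check_lam.prems A' in auto)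
  then show ?case using A' by (auto intro: check_synth_spine.intros)
next
  case (check_neutral \<Gamma> h S P' a T)
  from check_neutral.prems(6) obtain T' where A': "A' = Atom a T'" by (auto elim: ty_eq_AtomE)
  from check_neutral.IH(2)[OF check_neutral.prems(1-3)] obtain P0 where
    P0: "synth \<Xi> \<Sigma> p \<Gamma>' (ren_tm f (App h S)) P0" "ty_eq \<Sigma> (ren_ty f P') P0" by blast
  have "ty_eq \<Sigma> P0 A'"
    using ty_eq_trans ty_eq_sym[OF P0(2)] ty_eq_ren[OF check_neutral.IH(3)] check_neutral.prems(6) by blast
  then show ?case using P0(1) A' by (auto intro: check_synth_spine.intros)
next
  case (synth_app \<Gamma> h A S P)
  from head_ty_ren[OF \<Xi> synth_app.prems(1,3) synth_app.IH(1)] obtain A' where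
    A': "head_ty \<Xi> \<Sigma> p \<Gamma>' (ren_head f h) A'" "ty_eq \<Sigma> (ren_ty f A) A'" by blast
  from synth_app.IH(3)[OF synth_app.prems head_ty_sty_ok(1)[OF \<Xi> synth_app.prems(1) synth_app.IH(1)]
      head_ty_sty_ok(1)[OF \<Xi> synth_app.prems(2) A'(1)] A'(2)] A'(1)
  show ?case by (auto intro: check_synth_spine.intros)
next
  case (spine_nil \<Gamma> a T)
  then show ?case by (auto elim!: ty_eq_AtomE intro!: check_synth_spine.intros ty_eq.intros)
next
  case (spine_arg \<Gamma> M A2 A1 A1r S P)
  from spine_arg.prems(6) obtain A2' A1' where B': "B' = Pi Ord A2' A1'" "ty_eq \<Sigma> (ren_ty f A2) A2'"
    "ty_eq \<Sigma> (ren_ty (up f) A1) A1'" by (auto elim: ty_eq_PiE)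
  note f = spine_arg.prems(3)
  have ok: "sty_ok \<Sigma> (skel_ctx \<Gamma>) A2" "sty_ok \<Sigma> (cons_ctx (Ord, skel A2) (skel_ctx \<Gamma>)) A1"
    "sty_ok \<Sigma> (skel_ctx \<Gamma>') A2'" "sty_ok \<Sigma> (cons_ctx (Ord, skel A2') (skel_ctx \<Gamma>')) A1'"
    using spine_arg.prems(4,5) B' by auto
  have sk: "skel A2' = skel A2" using skel_ty_eq[OF B'(2)] by simp
  have M: "check \<Xi> \<Sigma> p \<Gamma>' (ren_tm f M) A2'"
    by (rule spine_arg.IH(2)[OF spine_arg.prems(1-3) ok(1,3) B'(2)])
  note Mt = check_stm(1)[OF \<Xi> M] and Mt0 = check_stm(1)[OF \<Xi> spine_arg.IH(1)]
  from hsub_sty_ok[OF ok(2), of 0 "skel A2" M] Mt0 spine_arg.hyps have A1r: "sty_ok \<Sigma> (skel_ctx \<Gamma>) A1r"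
    by (simp add: erase_skel)
  from hsub_sty_ok[OF ok(4), of 0 "skel A2'" "ren_tm f M"] Mt obtain B1 where
    B1: "hsub_ty (erase A2') (ren_tm f M) 0 A1' = Some B1" "sty_ok \<Sigma> (skel_ctx \<Gamma>') B1"
    by (auto simp: erase_skel)
  have "hsub_ty (erase A2) (ren_tm f M) 0 (ren_ty (up f) A1) = Some (ren_ty f A1r)"
    using hsub_ty_ren[OF sub_ren_compat_0, of "erase A2" f M A1] spine_arg.hyps by simp
  moreover have "sty_ok \<Sigma> (cons_ctx (Ord, skel A2') (skel_ctx \<Gamma>')) (ren_ty (up f) A1)"
    using sty_ok_ren[OF sren_up[OF ctx_ren_sren[OF f]] ok(2)] sk by simp
  \<comment> \<open>Conversion has to pass through the substitution in the dependent codomain; this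
    is where respect for equality of unfoldings enters.\<close>
  ultimately have "ty_eq \<Sigma> (ren_ty f A1r) B1"
    using hsub_ty_respects[OF B'(3) _ ok(4), of 0 "skel A2'" "ren_tm f M"] Mt B1(1) sk
    by (simp add: erase_skel)
  from spine_arg.IH(4)[OF spine_arg.prems(1-3) A1r B1(2) this] M B1(1) B'(1)
  show ?case by (auto intro: check_synth_spine.intros)
next
  case (spine_parg \<Gamma> y A2' A2 S A1 P)
  from spine_parg.prems(6) obtain C2 C1 where B': "B' = Pi Pre C2 C1" "ty_eq \<Sigma> (ren_ty f A2) C2"
    "ty_eq \<Sigma> (ren_ty (up f) A1) C1" by (auto elim: ty_eq_PiE)
  from spine_parg.hyps spine_parg.prems(3) obtain C2' where
    C2': "in_ctx \<Gamma>' (f y) Pre C2'" "ty_eq \<Sigma> (ren_ty f A2') C2'" unfolding ctx_ren_def by blast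
  have eq: "ty_eq \<Sigma> C2' C2"
    using ty_eq_trans ty_eq_sym[OF C2'(2)] ty_eq_ren[OF spine_parg.IH(1)] B'(2) by blast
  have y: "skel_ctx \<Gamma> y = Some (Pre, skel A2)" "skel_ctx \<Gamma>' (f y) = Some (Pre, skel C2)"
    using in_ctx_skel[OF spine_parg.hyps] in_ctx_skel[OF C2'(1)] skel_ty_eq[OF eq]
      skel_ty_eq[OF spine_parg.IH(1)] by auto
  have "\<exists>Q'. spine \<Xi> \<Sigma> p \<Gamma>' (ren_sp f S) (ren_ty (inst (f y)) C1) Q' \<and> ty_eq \<Sigma> (ren_ty f P) Q'"
  proof (rule spine_parg.IH(3)[OF spine_parg.prems(1-3)])
    show "sty_ok \<Sigma> (skel_ctx \<Gamma>) (ren_ty (inst y) A1)"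
      by (rule sty_ok_ren[OF sren_inst[of "skel_ctx \<Gamma>" y, OF y(1)]]) (use spine_parg.prems(4) in simp)
    show "sty_ok \<Sigma> (skel_ctx \<Gamma>') (ren_ty (inst (f y)) C1)"
      by (rule sty_ok_ren[OF sren_inst[of "skel_ctx \<Gamma>'" "f y", OF y(2)]]) (use spine_parg.prems(5) B' in simp)
    show "ty_eq \<Sigma> (ren_ty f (ren_ty (inst y) A1)) (ren_ty (inst (f y)) C1)"
      using ty_eq_ren[OF B'(3)] by (simp add: ren_inst_up)
  qed
  then show ?case using C2'(1) eq B'(1) by (auto intro: check_synth_spine.intros)
qed

text \<open>Indexed by the skeleton and not by the type: the domains met during reduction change
  under substitution and renaming, their skeletons do not.\<close>

definition subst_typing :: "signat \<Rightarrow> phase \<Rightarrow> sk \<Rightarrow> bool" where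
  "subst_typing \<Xi> p a \<longleftrightarrow> (\<forall>\<Gamma> \<Gamma>' \<Gamma>'' N A M B. skel A = a \<longrightarrow> sctx_ok \<Sigma> (\<Gamma>' @ (Ord, A) # \<Gamma>) \<longrightarrow>
     sty_ok \<Sigma> (skel_ctx (\<Gamma>' @ (Ord, A) # \<Gamma>)) B \<longrightarrow> check \<Xi> \<Sigma> p \<Gamma> N A \<longrightarrow>
     check \<Xi> \<Sigma> p (\<Gamma>' @ (Ord, A) # \<Gamma>) M B \<longrightarrow> hsub_ctx (erase A) N \<Gamma>' = Some \<Gamma>'' \<longrightarrow>
     (\<exists>M' B'. hsub_tm (erase A) N (length \<Gamma>') M = Some M' \<and> hsub_ty (erase A) N (length \<Gamma>') B = Some B' \<and>
        check \<Xi> \<Sigma> p (\<Gamma>'' @ \<Gamma>) M' B'))"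

lemma subst_typingD:
  assumes "subst_typing \<Xi> p (skel A)" "sctx_ok \<Sigma> (\<Gamma>' @ (Ord, A) # \<Gamma>)" "sty_ok \<Sigma> (skel_ctx (\<Gamma>' @ (Ord, A) # \<Gamma>)) B"
    "check \<Xi> \<Sigma> p \<Gamma> N A" "check \<Xi> \<Sigma> p (\<Gamma>' @ (Ord, A) # \<Gamma>) M B" "hsub_ctx (erase A) N \<Gamma>' = Some \<Gamma>''"
  obtains M' B' where "hsub_tm (erase A) N (length \<Gamma>') M = Some M'" "hsub_ty (erase A) N (length \<Gamma>') B = Some B'"
    "check \<Xi> \<Sigma> p (\<Gamma>'' @ \<Gamma>) M' B'"
  using assms unfolding subst_typing_def by metis

text \<open>Each ordinary argument is substituted at the strictly smaller skeleton of its domain,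
  and each prepattern argument is a renaming. The reduct synthesises \<open>P\<close> only up to
  equality, since the body reached at the end was checked and not synthesised.\<close>

lemma reduce_typing:
  assumes \<Xi>: "set \<Xi> \<subseteq> set \<Sigma>" and hyp: "\<And>c. size c < n \<Longrightarrow> subst_typing \<Xi> p c"
    and \<Gamma>: "sctx_ok \<Sigma> \<Gamma>"
  shows "spine \<Xi> \<Sigma> p \<Gamma> S A P \<Longrightarrow> check \<Xi> \<Sigma> p \<Gamma> N A \<Longrightarrow> sty_ok \<Sigma> (skel_ctx \<Gamma>) A \<Longrightarrow> size (skel A) \<le> n \<Longrightarrow>
    \<exists>R P0. reduce S (erase A) N = Some R \<and> synth \<Xi> \<Sigma> p \<Gamma> R P0 \<and> ty_eq \<Sigma> P0 P"
proof (induction S arbitrary: A N rule: sp_induct)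
  case SNil
  from SNil.prems(1) obtain a T where A: "A = Atom a T" "P = A" by (auto elim: spine.cases)
  with SNil.prems(2) obtain h S P' where "N = App h S" "synth \<Xi> \<Sigma> p \<Gamma> (App h S) P'" "ty_eq \<Sigma> P' A"
    by (auto elim: check.cases)
  then show ?case using A by auto
next
  case (Arg X S)
  from Arg.prems(1) obtain A2 A1 A1' where A: "A = Pi Ord A2 A1" "check \<Xi> \<Sigma> p \<Gamma> X A2"
    "hsub_ty (erase A2) X 0 A1 = Some A1'" "spine \<Xi> \<Sigma> p \<Gamma> S A1' P" by (auto elim: spine.cases)
  with Arg.prems(2) obtain N1 where N: "N = Lam N1" "check \<Xi> \<Sigma> p ((Ord, A2) # \<Gamma>) N1 A1"
    by (auto elim: check.cases)
  have "subst_typing \<Xi> p (skel A2)" using Arg.prems(4) A(1) by (intro hyp) simp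
  from subst_typingD[OF this, of "[]" \<Gamma> A1 X N1 "[]"] A N Arg.prems(3) \<Gamma> obtain N1' where
    N1': "hsub_tm (erase A2) X 0 N1 = Some N1'" "check \<Xi> \<Sigma> p \<Gamma> N1' A1'" by auto
  have "sty_ok \<Sigma> (skel_ctx \<Gamma>) A1'"
    using hsub_sty_ok[of \<Sigma> "cons_ctx (Ord, skel A2) (skel_ctx \<Gamma>)" A1 0 "skel A2" X]
      A check_stm(1)[OF \<Xi> A(2)] Arg.prems(3) by (auto simp: erase_skel)
  moreover have "skel A1' = skel A1" by (rule skel_hsub[OF A(3)])
  moreover then have "erase A1' = erase A1" by (simp add: erase_skel)
  ultimately show ?case using Arg.IH[OF A(4) N1'(2)] Arg.prems(4) A N N1'(1) by simp
next
  case (PArg y S)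
  from PArg.prems(1) obtain A2 A1 A2' where A: "A = Pi Pre A2 A1" "in_ctx \<Gamma> y Pre A2'" "ty_eq \<Sigma> A2' A2"
    "spine \<Xi> \<Sigma> p \<Gamma> S (ren_ty (inst y) A1) P" by (auto elim: spine.cases)
  with PArg.prems(2) obtain N1 where N: "N = Lam N1" "check \<Xi> \<Sigma> p ((Pre, A2) # \<Gamma>) N1 A1"
    by (auto elim: check.cases)
  have y: "skel_ctx \<Gamma> y = Some (Pre, skel A2)" using in_ctx_skel[OF A(2)] skel_ty_eq[OF A(3)] by simp
  have ok: "sty_ok \<Sigma> (skel_ctx \<Gamma>) (ren_ty (inst y) A1)"
    by (rule sty_ok_ren[OF sren_inst[of "skel_ctx \<Gamma>" y, OF y(1)]]) (use PArg.prems(3) A in simp)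
  have "check \<Xi> \<Sigma> p \<Gamma> (ren_tm (inst y) N1) (ren_ty (inst y) A1)"
    by (rule typing_ren_conv(1)[OF \<Xi> N(2) _ \<Gamma> ctx_ren_inst[OF \<Gamma> A(2,3)] _ ok ty_eq_refl[OF ok]])
      (use PArg.prems(3) A \<Gamma> in simp_all)
  from PArg.IH[OF A(4) this ok] show ?case using PArg.prems(4) A N by (simp add: erase_skel)
qed

text \<open>The part for \<open>synth\<close> also delivers simple well-formedness of
  \<open>P\<close>, because \<open>check_neutral\<close> must carry its conversion through the
  substitution and \<open>hsub_ty_respects\<close> asks for both types to be well formed.\<close>

lemma subst_typing_step:
  assumes \<Xi>: "set \<Xi> \<subseteq> set \<Sigma>" and hyp: "\<And>c. size c < size (skel A) \<Longrightarrow> subst_typing \<Xi> p c"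
    and N: "check \<Xi> \<Sigma> p \<Gamma> N A"
  shows "check \<Xi> \<Sigma> p \<Theta> M B \<Longrightarrow> \<Theta> = \<Gamma>' @ (Ord, A) # \<Gamma> \<Longrightarrow> sctx_ok \<Sigma> \<Theta> \<Longrightarrow> sty_ok \<Sigma> (skel_ctx \<Theta>) B \<Longrightarrow>
      hsub_ctx (erase A) N \<Gamma>' = Some \<Gamma>'' \<Longrightarrow>
      \<exists>M' B'. hsub_tm (erase A) N (length \<Gamma>') M = Some M' \<and> hsub_ty (erase A) N (length \<Gamma>') B = Some B' \<and>
        check \<Xi> \<Sigma> p (\<Gamma>'' @ \<Gamma>) M' B'"
    and "synth \<Xi> \<Sigma> p \<Theta> R P \<Longrightarrow> \<Theta> = \<Gamma>' @ (Ord, A) # \<Gamma> \<Longrightarrow> sctx_ok \<Sigma> \<Theta> \<Longrightarrow>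
      hsub_ctx (erase A) N \<Gamma>' = Some \<Gamma>'' \<Longrightarrow>
      sty_ok \<Sigma> (skel_ctx \<Theta>) P \<and>
      (\<exists>R' P' P0. hsub_tm (erase A) N (length \<Gamma>') R = Some R' \<and> hsub_ty (erase A) N (length \<Gamma>') P = Some P' \<and>
        synth \<Xi> \<Sigma> p (\<Gamma>'' @ \<Gamma>) R' P0 \<and> ty_eq \<Sigma> P0 P')"
    and "spine \<Xi> \<Sigma> p \<Theta> S C Q \<Longrightarrow> \<Theta> = \<Gamma>' @ (Ord, A) # \<Gamma> \<Longrightarrow> sctx_ok \<Sigma> \<Theta> \<Longrightarrow> sty_ok \<Sigma> (skel_ctx \<Theta>) C \<Longrightarrow>
      hsub_ctx (erase A) N \<Gamma>' = Some \<Gamma>'' \<Longrightarrow>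
      \<exists>S' C' Q'. hsub_sp (erase A) N (length \<Gamma>') S = Some S' \<and> hsub_ty (erase A) N (length \<Gamma>') C = Some C' \<and>
        hsub_ty (erase A) N (length \<Gamma>') Q = Some Q' \<and> spine \<Xi> \<Sigma> p (\<Gamma>'' @ \<Gamma>) S' C' Q'"
proof (induction arbitrary: \<Gamma>' \<Gamma>'' and \<Gamma>' \<Gamma>'' and \<Gamma>' \<Gamma>'' rule: check_synth_spine.inducts)
  note Nt = check_stm(1)[OF \<Xi> N]
  note hs = hsub_sty_ok[of \<Sigma> "skel_ctx (\<Gamma>' @ (Ord, A) # \<Gamma>)" _ "length \<Gamma>'" "skel A" N for \<Gamma>',
      unfolded skel_ctx_insert, OF _ refl Nt, folded erase_skel]
  note hr = hsub_ty_respects[of _ _ "skel_ctx (\<Gamma>' @ (Ord, A) # \<Gamma>)" "length \<Gamma>'" "skel A" N for \<Gamma>',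
      unfolded skel_ctx_insert, OF _ _ _ refl Nt, folded erase_skel]
  {
    case (check_lam m A2 \<Theta> M A1)
    from check_lam.prems(1,3) hs[of \<Gamma>' A2] obtain A2' where
      A2': "hsub_ty (erase A) N (length \<Gamma>') A2 = Some A2'" by auto
    from check_lam.IH(2)[of "(m, A2) # \<Gamma>'" "(m, A2') # \<Gamma>''"] check_lam.prems A2'
    show ?case by (auto intro: check_synth_spine.intros)
  next
    case (check_neutral \<Theta> h S P a T)
    from check_neutral.IH(2)[OF check_neutral.prems(1,2,4)] obtain R' P' P0 where
      P: "sty_ok \<Sigma> (skel_ctx \<Theta>) P" and R': "hsub_tm (erase A) N (length \<Gamma>') (App h S) = Some R'"
      and P': "hsub_ty (erase A) N (length \<Gamma>') P = Some P'"
      and P0: "synth \<Xi> \<Sigma> p (\<Gamma>'' @ \<Gamma>) R' P0" "ty_eq \<Sigma> P0 P'" by blast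
    from hs[of \<Gamma>' "Atom a T"] check_neutral.prems(1,3) obtain T' where
      T': "hsub_ty (erase A) N (length \<Gamma>') (Atom a T) = Some (Atom a T')" by auto
    have "ty_eq \<Sigma> P' (Atom a T')"
      using hr[OF check_neutral.IH(3) _ _ P' T'] P check_neutral.prems(1,3) by blast
    then have "ty_eq \<Sigma> P0 (Atom a T')" using ty_eq_trans P0(2) by blast
    moreover obtain h' S' where "R' = App h' S'" using P0(1) by (auto elim: synth.cases)
    ultimately show ?case using R' T' P0(1) by (auto intro: check_synth_spine.intros)
  next
    case (synth_app \<Theta> h C S P)
    let ?k = "length \<Gamma>'"
    note C = head_ty_sty_ok[OF \<Xi> synth_app.prems(2) synth_app.IH(1)]
    note P = spine_sty_ok[OF \<Xi> synth_app.IH(2) C(1)]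
    from synth_app.IH(3)[OF synth_app.prems(1,2) C(1) synth_app.prems(3)] obtain S' C' P' where
      S': "hsub_sp (erase A) N ?k S = Some S'" and C': "hsub_ty (erase A) N ?k C = Some C'"
      and P': "hsub_ty (erase A) N ?k P = Some P'" and sp: "spine \<Xi> \<Sigma> p (\<Gamma>'' @ \<Gamma>) S' C' P'" by blast
    from hsub_ctx_ok[OF synth_app.prems(2)[unfolded synth_app.prems(1)] Nt] synth_app.prems(3)
    have \<Gamma>'': "length \<Gamma>'' = ?k" "sctx_ok \<Sigma> (\<Gamma>'' @ \<Gamma>)"
      "skel_ctx (\<Gamma>'' @ \<Gamma>) = del_ctx ?k (skel_ctx \<Theta>)" using synth_app.prems(1) by auto
    have C'ok: "sty_ok \<Sigma> (skel_ctx (\<Gamma>'' @ \<Gamma>)) C'" using hs[of \<Gamma>' C] C(1) C' synth_app.prems(1) \<Gamma>''(3) by auto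
    have "\<exists>R' P0. hsub_tm (erase A) N ?k (App h S) = Some R' \<and> synth \<Xi> \<Sigma> p (\<Gamma>'' @ \<Gamma>) R' P0 \<and> ty_eq \<Sigma> P0 P'"
    proof (cases "h = Var ?k")
      case True
      then obtain m where "in_ctx \<Theta> ?k m C" using synth_app.IH(1) by (auto elim: head_ty.cases)
      from in_ctx_hsub_eq(2)[OF this[unfolded synth_app.prems(1)]] C'
      have C'A: "C' = ren_ty (\<lambda>i. i + ?k) A" by simp
      have \<Gamma>: "sctx_ok \<Sigma> \<Gamma>" "sty_ok \<Sigma> (skel_ctx \<Gamma>) A"
        using synth_app.prems(1,2) by (induction \<Gamma>' arbitrary: \<Theta>) auto
      \<comment> \<open>The type of \<open>x\<close> does not mention \<open>x\<close>, so after
        substitution it is \<open>A\<close> weakened over \<Gamma>'', and \<open>N\<close> weakened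
        likewise has that type.\<close>
      have "check \<Xi> \<Sigma> p (\<Gamma>'' @ \<Gamma>) (ren_tm (\<lambda>i. i + ?k) N) C'"
        by (rule typing_ren_conv(1)[OF \<Xi> N \<Gamma>(1) \<Gamma>''(2) _ \<Gamma>(2) C'ok])
          (use ctx_ren_weaken[OF \<Gamma>(1), of \<Gamma>''] \<Gamma>''(1) C'A ty_eq_refl[OF C'ok] in simp_all)
      from reduce_typing[OF \<Xi> hyp \<Gamma>''(2) sp this C'ok] C'A S' True show ?thesis by (auto simp: erase_skel)
    next
      case False
      have "head_ty \<Xi> \<Sigma> p (\<Gamma>'' @ \<Gamma>) (ren_head (drop_var ?k) h) C'"
      proof (cases "\<exists>i. h = Var i")
        case True
        then obtain i m where i: "h = Var i" "in_ctx \<Theta> i m C" using synth_app.IH(1) by (auto elim: head_ty.cases)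
        with in_ctx_hsub[OF synth_app.prems(3) i(2)[unfolded synth_app.prems(1)]] False C'
        show ?thesis by (auto intro: head_ty.intros)
      next
        case nv: False
        \<comment> \<open>Types of constants are closed and thus unaffected.\<close>
        from hsub_ty_closed[OF C(2)[OF nv]] C' have "C' = C" by simp
        then show ?thesis using synth_app.IH(1) nv by (auto elim!: head_ty.cases intro: head_ty.intros)
      qed
      moreover have "ty_eq \<Sigma> P' P'"
        using ty_eq_refl hs[of \<Gamma>' P] P P' synth_app.prems(1) by fastforce
      ultimately show ?thesis using S' sp False by (auto intro: check_synth_spine.intros)
    qed
    then show ?case using P P' by blast
  next
    case (spine_nil \<Theta> a T)
    from hs[of \<Gamma>' "Atom a T"] spine_nil.prems(1,3) obtain T' where
      T': "hsub_ty (erase A) N (length \<Gamma>') (Atom a T) = Some (Atom a T')" by auto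
    then show ?case by (auto intro: check_synth_spine.intros)
  next
    case (spine_arg \<Theta> M A2 A1 A1r S P)
    let ?k = "length \<Gamma>'"
    let ?D = "cons_ctx (Ord, skel A2) (skel_ctx \<Theta>)"
    have ok: "sty_ok \<Sigma> (skel_ctx \<Theta>) A2" "sty_ok \<Sigma> ?D A1" using spine_arg.prems(3) by auto
    note Mt = check_stm(1)[OF \<Xi> spine_arg.IH(1)]
    have A1r: "sty_ok \<Sigma> (skel_ctx \<Theta>) A1r"
      using hsub_sty_ok[OF ok(2), of 0 "skel A2" M] Mt spine_arg.hyps by (auto simp: erase_skel)
    from spine_arg.IH(2)[OF spine_arg.prems(1,2) ok(1) spine_arg.prems(4)] obtain M' A2' where
      M': "hsub_tm (erase A) N ?k M = Some M'" and A2': "hsub_ty (erase A) N ?k A2 = Some A2'"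
      and ch: "check \<Xi> \<Sigma> p (\<Gamma>'' @ \<Gamma>) M' A2'" by blast
    from spine_arg.IH(4)[OF spine_arg.prems(1,2) A1r spine_arg.prems(4)] obtain S' A1r' P' where
      S': "hsub_sp (erase A) N ?k S = Some S'" and A1r': "hsub_ty (erase A) N ?k A1r = Some A1r'"
      and P': "hsub_ty (erase A) N ?k P = Some P'" and sp: "spine \<Xi> \<Sigma> p (\<Gamma>'' @ \<Gamma>) S' A1r' P'" by blast
    from hs[of "(Ord, A2) # \<Gamma>'" A1] ok(2) spine_arg.prems(1) obtain A1' where
      A1': "hsub_ty (erase A) N (Suc ?k) A1 = Some A1'" by auto
    \<comment> \<open>The composition law for types, with the argument \<open>M\<close> at index 0
      and \<open>x\<close> at index \<open>?k\<close> outside it: substituting in the instantiated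
      codomain agrees with instantiating the substituted codomain.\<close>
    have "hsub_ty (erase A) N ?k A1r = hsub_ty (erase A2) M' 0 A1'"
      using hsub_ty_comm[OF ok(2), of 0 "skel A2" ?k "skel A" M N A1r A1' M']
        skel_ctx_insert[of \<Gamma>' Ord A \<Gamma>] Mt Nt spine_arg.hyps A1' M'
      unfolding spine_arg.prems(1) by (simp add: erase_skel)
    moreover have "erase A2' = erase A2" using skel_hsub[OF A2'] by (simp add: erase_skel)
    ultimately have "hsub_ty (erase A2') M' 0 A1' = Some A1r'" using A1r' by simp
    with ch sp have "spine \<Xi> \<Sigma> p (\<Gamma>'' @ \<Gamma>) (Arg M' S') (Pi Ord A2' A1') P'"
      by (auto intro: check_synth_spine.intros)
    then show ?case using M' S' A2' A1' P' by simp
  next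
    case (spine_parg \<Theta> y A2' A2 S A1 P)
    let ?k = "length \<Gamma>'"
    have ok: "sty_ok \<Sigma> (skel_ctx \<Theta>) A2" "sty_ok \<Sigma> (cons_ctx (Pre, skel A2) (skel_ctx \<Theta>)) A1"
      using spine_parg.prems(3) by auto
    \<comment> \<open>\<open>y\<close> has mode \<open>Pre\<close> while \<open>x\<close> has mode
      \<open>Ord\<close>, so the undefined case \<open>[x]\<close> cannot arise.\<close>
    have yk: "y \<noteq> ?k" using in_ctx_hsub_eq(1) spine_parg.hyps spine_parg.prems(1) by blast
    from in_ctx_hsub[OF spine_parg.prems(4) spine_parg.hyps[unfolded spine_parg.prems(1)] yk] obtain B2 where
      B2: "hsub_ty (erase A) N ?k A2' = Some B2" "in_ctx (\<Gamma>'' @ \<Gamma>) (drop_var ?k y) Pre B2" by blast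
    from hs[of \<Gamma>' A2] ok(1) spine_parg.prems(1) obtain C2 where
      C2: "hsub_ty (erase A) N ?k A2 = Some C2" by auto
    have eq: "ty_eq \<Sigma> B2 C2"
      using hr[OF spine_parg.IH(1) _ _ B2(1) C2] ok(1) in_ctx_sty_ok[OF spine_parg.prems(2) spine_parg.hyps]
        spine_parg.prems(1) by blast
    from hs[of "(Pre, A2) # \<Gamma>'" A1] ok(2) spine_parg.prems(1) obtain C1 where
      C1: "hsub_ty (erase A) N (Suc ?k) A1 = Some C1" by auto
    have y: "skel_ctx \<Theta> y = Some (Pre, skel A2)"
      using in_ctx_skel[OF spine_parg.hyps] skel_ty_eq[OF spine_parg.IH(1)] by simp
    have "sty_ok \<Sigma> (skel_ctx \<Theta>) (ren_ty (inst y) A1)"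
      by (rule sty_ok_ren[OF sren_inst[of "skel_ctx \<Theta>" y, OF y] ok(2)])
    from spine_parg.IH(3)[OF spine_parg.prems(1,2) this spine_parg.prems(4)] obtain S' D P' where
      S': "hsub_sp (erase A) N ?k S = Some S'" and D: "hsub_ty (erase A) N ?k (ren_ty (inst y) A1) = Some D"
      and P': "hsub_ty (erase A) N ?k P = Some P'" and sp: "spine \<Xi> \<Sigma> p (\<Gamma>'' @ \<Gamma>) S' D P'" by blast
    have "D = ren_ty (inst (drop_var ?k y)) C1"
      using hsub_ty_ren[OF sub_ren_compat_inst[OF yk], of "erase A" N A1] C1 D by simp
    with B2(2) eq sp have "spine \<Xi> \<Sigma> p (\<Gamma>'' @ \<Gamma>) (PArg (drop_var ?k y) S') (Pi Pre C2 C1) P'"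
      by (auto intro: check_synth_spine.intros)
    then show ?case using yk S' C2 C1 P' by simp
  }
qed

lemma subst_typing:
  assumes "set \<Xi> \<subseteq> set \<Sigma>"
  shows "subst_typing \<Xi> p a"
proof (induction "size a" arbitrary: a rule: less_induct)
  case less
  then show ?case unfolding subst_typing_def[of \<Xi> p a]
    using subst_typing_step(1)[OF assms _ _ _ refl] by blast
qed

end

theorem theorem4:
  fixes \<Sigma> \<Xi> :: signat and p :: phase and \<Gamma> \<Gamma>' :: ctx and A B :: ty and L :: kind and M N :: tm
  assumes "sig_ok \<Sigma>"
    and "prefix \<Xi> \<Sigma>"
    and "ctx_ok \<Xi> \<Sigma> p (\<Gamma>' @ (Ord, A) # \<Gamma>)"
    and "ty_ok \<Xi> \<Sigma> p (\<Gamma>' @ (Ord, A) # \<Gamma>) B L"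
    and "check \<Xi> \<Sigma> p \<Gamma> N A"
    and "check \<Xi> \<Sigma> p (\<Gamma>' @ (Ord, A) # \<Gamma>) M B"
  shows "\<exists>\<Gamma>'' M' B'.
           hsub_ctx (erase A) N \<Gamma>' = Some \<Gamma>'' \<and>
           hsub_tm (erase A) N (length \<Gamma>') M = Some M' \<and>
           hsub_ty (erase A) N (length \<Gamma>') B = Some B' \<and>
           check \<Xi> \<Sigma> p (\<Gamma>'' @ \<Gamma>) M' B'"
proof -
  interpret colf_sig \<Sigma> by standard (rule assms(1))
  have \<Xi>: "set \<Xi> \<subseteq> set \<Sigma>" using assms(2) by (rule set_mono_prefix)
  note ctx = ctx_ok_sctx_ok[OF \<Xi> assms(3)]
  from hsub_ctx_ok[OF ctx check_stm(1)[OF \<Xi> assms(5)]] obtain \<Gamma>'' where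
    \<Gamma>'': "hsub_ctx (erase A) N \<Gamma>' = Some \<Gamma>''" by blast
  from subst_typingD[OF subst_typing[OF \<Xi>] ctx ty_ok_sty_ok[OF \<Xi> assms(4)] assms(5,6) \<Gamma>''] \<Gamma>''
  show ?thesis by metis
qed

end
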